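(* Let $d\in\mathbb{N}$, let $\mu$ be an arbitrary probability measure on $\mathbb{R}^d$ and let $\pi_a$ be a probability density on $\mathbb{R}^d$. For any $n\in\mathbb{N}$ and any $f\in\overline{\mathcal F}$ (the function class depending on $\pi_a$ defined in the context), there exists an $\mathbb{R}^n$-valued $\sigma(\mathbf A,\mathbf B)$-measurable random vector $\boldsymbol W$ such that the quantum random neural network $F_{\boldsymbol W}$ (defined in the context) satisfies $$\mathbb{E}\left[\int_{\mathbb{R}^d}\left|F_{\boldsymbol W}(\boldsymbol x)-f(\boldsymbol x)\right|^2\mu(d\boldsymbol x)\right]^{1/2}\le\frac{\overline L_2[f]}{\sqrt n},\qquad \overline L_2[f]:=\left(2\int_{\mathbb{R}^d}\frac{|\widehat f(\boldsymbol\xi)|^2}{\pi_a(\boldsymbol\xi)}\,d\boldsymbol\xi\right)^{1/2}.$$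
   Context: Fourier transform: $\widehat f(\boldsymbol\xi)=\int_{\mathbb{R}^d}e^{-2\pi \mathrm{i}\,\boldsymbol y\cdot\boldsymbol\xi}f(\boldsymbol y)\,d\boldsymbol y$. The class $\overline{\mathcal F}$ consists of all $f:\mathbb{R}^d\to\mathbb{R}$ that are continuous and Lebesgue-integrable, with $\widehat f\in L^1(\mathbb{R}^d)$, $|\widehat f|\ll\pi_a$ (the measure with Lebesgue density $|\widehat f|$ is absolutely continuous with respect to the measure with Lebesgue density $\pi_a$) and $\int_{\mathbb{R}^d}|\widehat f(\boldsymbol\xi)|^2/\pi_a(\boldsymbol\xi)\,d\boldsymbol\xi<\infty$ (with $0/0=0$). Random parameters: $\mathbf B=(B^i)_{i=1,\dots,n}$ are i.i.d. with $\mathbb{P}(B^i=0)=\mathbb{P}(B^i=1)=\frac12$; $\mathbf A=(\mathbf A^i)_{i=1,\dots,n}$ are i.i.d. $\mathbb{R}^d$-valued with density $\pi_a$, $\mathbf A^i=(A^i_1,\dots,A^i_d)$; $\mathbf A$ and $\mathbf B$ are independent; $\sigma(\mathbf A,\mathbf B)$ is the $\sigma$-algebra they generate. Random quantum circuit. With $\mathtt H=\frac1{\sqrt2}\begin{pmatrix}1&1\\1&-1\end{pmatrix}$ and $\mathtt R_z(\alpha)=\begin{pmatrix}e^{-\mathrm i\alpha/2}&0\\0&e^{\mathrm i\alpha/2}\end{pmatrix}$, for $\boldsymbol x\in\mathbb{R}^d$ and $i=1,\dots,n$ let $\overline{\mathtt U}_1^{(i)}(\boldsymbol x)=\mathtt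 H\,\mathtt R_z(-\tfrac\pi2B^i)\,\mathtt R_z(-2\pi A^i_dx_d)\cdots\mathtt R_z(-2\pi A^i_1x_1)\,\mathtt H$. Let $\overline n_0\ge0$ be the smallest integer with $\log_2(2n+\overline n_0)\in\mathbb{N}$, $\overline{\mathfrak n}=\lceil\log_2(2n)\rceil$, $\overline N=2n+\overline n_0=2^{\overline{\mathfrak n}}$, and let $\overline{\mathtt U}(\boldsymbol x)\in\mathbb{C}^{\overline N\times\overline N}$ be block-diagonal with diagonal blocks $\overline{\mathtt U}_1^{(1)}(\boldsymbol x),\dots,\overline{\mathtt U}_1^{(n)}(\boldsymbol x)$ and the $\overline n_0\times\overline n_0$ identity. Let $|0\rangle,\dots,|\overline N-1\rangle$ be the computational (standard) basis of $\mathbb{C}^{\overline N}$, $|0\rangle=|0\rangle^{\otimes\overline{\mathfrak n}}$, and let $\overline{\mathtt V}$ be any unitary matrix mapping $|0\rangle^{\otimes\overline{\mathfrak n}}$ to $\frac1{\sqrt n}\sum_{i=0}^{n-1}|2i\rangle$. Put $\overline{\mathbb P}_k(\boldsymbol x)=|\langle k|\overline{\mathtt U}(\boldsymbol x)\overline{\mathtt V}|0\rangle^{\otimes\overline{\mathfrak n}}|^2$ for $k=0,\dots,\overline N-1$ (the probability of measuring $k$; it depends on the realisation of $\mathbf A,\mathbf B$). For $\boldsymbol w=(w_0,\dots,w_{n-1})\in\mathbb{R}^n$, $$F_{\boldsymbol w}(\boldsymbol x)=\sum_{j=0}^{n-1}w_j\left(2\overline{\mathbb P}_{2j}(\boldsymbol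 x)-\frac1n\right).$$ *)

theory Defs
  imports
    "HOL-Probability.Probability"
    "Jordan_Normal_Form.Schur_Decomposition"
begin

definition fourier :: "(real ^ 'd \<Rightarrow> real) \<Rightarrow> real ^ 'd \<Rightarrow> complex" where
  "fourier f \<xi> =
     (\<integral>y. exp (- 2 * complex_of_real pi * \<i> * complex_of_real (inner y \<xi>))
            * complex_of_real (f y) \<partial>lborel)"

text \<open>In \<^typ>\<open>ennreal\<close> one has \<open>0 / 0 = 0\<close> and \<open>c / 0 = \<infinity>\<close> for \<open>c > 0\<close>, which is the
  convention needed for this integral.\<close>

definition weighted_energy :: "(real ^ 'd \<Rightarrow> real) \<Rightarrow> (real ^ 'd \<Rightarrow> real) \<Rightarrow> ennreal" where
  "weighted_energy p f =
     (\<integral>\<^sup>+ \<xi>. ennreal ((cmod (fourier f \<xi>))\<^sup>2) / ennreal (p \<xi>) \<partial>lborel)"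

definition Fbar :: "(real ^ 'd \<Rightarrow> real) \<Rightarrow> (real ^ 'd \<Rightarrow> real) set" where
  "Fbar p = {f. continuous_on UNIV f \<and> integrable lborel f
     \<and> integrable lborel (fourier f)
     \<and> absolutely_continuous (density lborel (\<lambda>\<xi>. ennreal (p \<xi>)))
                             (density lborel (\<lambda>\<xi>. ennreal (cmod (fourier f \<xi>))))
     \<and> weighted_energy p f < \<infinity>}"

definition L2bar :: "(real ^ 'd \<Rightarrow> real) \<Rightarrow> (real ^ 'd \<Rightarrow> real) \<Rightarrow> real" where
  "L2bar p f = sqrt (2 * enn2real (weighted_energy p f))"

definition hadamard :: "complex mat" where
  "hadamard = complex_of_real (1 / sqrt 2) \<cdot>\<^sub>m mat_of_rows_list 2 [[1, 1], [1, - 1]]"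

definition Rz :: "real \<Rightarrow> complex mat" where
  "Rz \<alpha> = mat_of_rows_list 2
     [[exp (- \<i> * complex_of_real \<alpha> / 2), 0], [0, exp (\<i> * complex_of_real \<alpha> / 2)]]"

text \<open>The linear order on the index type fixes the coordinates \<open>1, \<dots>, d\<close>; folding over the
  increasing enumeration puts the factor of the last coordinate leftmost.\<close>

definition U1 :: "real ^ 'd::{finite,linorder} \<Rightarrow> real \<Rightarrow> real ^ 'd::{finite,linorder} \<Rightarrow> complex mat" where
  "U1 a b x = hadamard * (Rz (- (pi / 2) * b) *
     fold (\<lambda>j X. Rz (- 2 * pi * vec_nth a j * vec_nth x j) * X)
       (sorted_list_of_set UNIV) hadamard)"

definition n0bar :: "nat \<Rightarrow> nat" where
  "n0bar n = (LEAST k. log 2 (real (2 * n + k)) \<in> \<nat>)"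

definition qubits :: "nat \<Rightarrow> nat" where
  "qubits n = nat \<lceil>log 2 (real (2 * n))\<rceil>"

definition Nbar :: "nat \<Rightarrow> nat" where
  "Nbar n = 2 * n + n0bar n"

lemma Nbar_eq_power:
  assumes "n \<ge> 1"
  shows "Nbar n = 2 ^ qubits n"
proof -
  define m where "m = qubits n"
  have n: "real (2 * n) > 0" "log 2 (real (2 * n)) \<ge> 0" using assms by auto
  have "log 2 (real (2 * n)) \<le> real m"
    unfolding m_def qubits_def using n by linarith
  hence "real (2 * n) \<le> 2 ^ m"
    using n(1) by (simp add: log_le_iff powr_realpow)
  hence le: "2 * n \<le> 2 ^ m" by (metis of_nat_le_iff of_nat_numeral of_nat_power)
  have "n0bar n = 2 ^ m - 2 * n"
    unfolding n0bar_def
  proof (rule Least_equality)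
    have "real (2 * n + (2 ^ m - 2 * n)) = 2 ^ m" using le by simp
    thus "log 2 (real (2 * n + (2 ^ m - 2 * n))) \<in> \<nat>" by (simp only:) simp
  next
    fix k assume "log 2 (real (2 * n + k)) \<in> \<nat>"
    then obtain j where j: "log 2 (real (2 * n + k)) = real j" by (elim Nats_cases)
    have "real (2 * n + k) = 2 powr (real j)" unfolding j[symmetric] using assms by simp
    hence "real (2 * n + k) = real (2 ^ j)" by (simp add: powr_realpow)
    hence eq: "2 * n + k = 2 ^ j" by (simp only: of_nat_eq_iff)
    have "log 2 (real (2 * n)) \<le> real j" unfolding j[symmetric] using n(1) by simp
    hence "m \<le> j" unfolding m_def qubits_def by (simp add: ceiling_le_iff nat_le_iff)
    hence "(2::nat) ^ m \<le> 2 ^ j" by simp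
    thus "2 ^ m - 2 * n \<le> k" using eq by linarith
  qed
  thus ?thesis unfolding Nbar_def m_def[symmetric] using le by simp
qed

definition Ubar ::
  "nat \<Rightarrow> (nat \<Rightarrow> real ^ 'd::{finite,linorder}) \<Rightarrow> (nat \<Rightarrow> real) \<Rightarrow> real ^ 'd::{finite,linorder} \<Rightarrow> complex mat" where
  "Ubar n a b x = diag_block_mat (map (\<lambda>i. U1 (a i) (b i) x) [1..<Suc n] @ [1\<^sub>m (n0bar n)])"

text \<open>The basis state \<open>|k\<rangle>\<close> is \<^term>\<open>unit_vec (Nbar n) k :: complex vec\<close>; by the lemma above the state
  \<open>|0\<rangle>\<close> of all \<^term>\<open>qubits n\<close> qubits is the one with \<open>k = 0\<close>.\<close>

definition state_prep :: "nat \<Rightarrow> complex mat \<Rightarrow> bool" where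
  "state_prep n V \<longleftrightarrow>
     V \<in> carrier_mat (Nbar n) (Nbar n)
   \<and> mat_adjoint V * V = 1\<^sub>m (Nbar n) \<and> V * mat_adjoint V = 1\<^sub>m (Nbar n)
   \<and> V *\<^sub>v unit_vec (Nbar n) 0 =
       complex_of_real (1 / sqrt (real n)) \<cdot>\<^sub>v
         finsum_vec TYPE(complex) (Nbar n) (\<lambda>i. unit_vec (Nbar n) (2 * i)) {0..<n}"

text \<open>In \<^term>\<open>v \<bullet>c w\<close> the second argument is the conjugated one, so the amplitude
  \<open>\<langle>k|\<psi>\<rangle>\<close> is \<open>\<psi> \<bullet>c |k\<rangle>\<close>.\<close>

definition Pbar ::
  "nat \<Rightarrow> complex mat \<Rightarrow> (nat \<Rightarrow> real ^ 'd::{finite,linorder}) \<Rightarrow> (nat \<Rightarrow> real) \<Rightarrow> nat \<Rightarrow>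
   real ^ 'd::{finite,linorder} \<Rightarrow> real" where
  "Pbar n V a b k x =
     (cmod ((Ubar n a b x *\<^sub>v (V *\<^sub>v unit_vec (Nbar n) 0)) \<bullet>c unit_vec (Nbar n) k))\<^sup>2"

definition qrnn ::
  "nat \<Rightarrow> complex mat \<Rightarrow> (nat \<Rightarrow> real ^ 'd::{finite,linorder}) \<Rightarrow> (nat \<Rightarrow> real) \<Rightarrow>
   (nat \<Rightarrow> real) \<Rightarrow> real ^ 'd::{finite,linorder} \<Rightarrow> real" where
  "qrnn n V a b w x = (\<Sum>j=0..<n. w j * (2 * Pbar n V a b (2 * j) x - 1 / real n))"

text \<open>\<open>\<real>\<^sup>n\<close>- and \<open>(\<real>\<^sup>d)\<^sup>n\<close>-valued random vectors with varying \<open>n\<close> take values in finite product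
  spaces \<^const>\<open>PiM\<close>.\<close>

definition rvec :: "nat \<Rightarrow> (nat \<Rightarrow> 'w \<Rightarrow> 'a) \<Rightarrow> 'w \<Rightarrow> nat \<Rightarrow> 'a" where
  "rvec n X \<omega> = (\<lambda>i\<in>{1..n}. X i \<omega>)"

definition sigma_AB ::
  "'w measure \<Rightarrow> nat \<Rightarrow> (nat \<Rightarrow> 'w \<Rightarrow> real ^ 'd) \<Rightarrow> (nat \<Rightarrow> 'w \<Rightarrow> real) \<Rightarrow> 'w measure" where
  "sigma_AB M n A B = vimage_algebra (space M) (\<lambda>\<omega>. (rvec n A \<omega>, rvec n B \<omega>))
     ((\<Pi>\<^sub>M i\<in>{1..n}. borel) \<Otimes>\<^sub>M (\<Pi>\<^sub>M i\<in>{1..n}. borel))"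

text \<open>The library notion of independence of two random variables requires equal value types, hence
  independence of \<open>A\<close> and \<open>B\<close> is stated for the generated \<open>\<sigma>\<close>-algebras.\<close>

definition random_params ::
  "'w measure \<Rightarrow> nat \<Rightarrow> (real ^ 'd \<Rightarrow> real) \<Rightarrow> (nat \<Rightarrow> 'w \<Rightarrow> real ^ 'd) \<Rightarrow>
   (nat \<Rightarrow> 'w \<Rightarrow> real) \<Rightarrow> bool" where
  "random_params M n p A B \<longleftrightarrow>
     (\<forall>i\<in>{1..n}. distributed M lborel (A i) (\<lambda>\<xi>. ennreal (p \<xi>)))
   \<and> prob_space.indep_vars M (\<lambda>_. borel) A {1..n}
   \<and> (\<forall>i\<in>{1..n}. B i \<in> borel_measurable M
        \<and> measure M {\<omega> \<in> space M. B i \<omega> = 0} = 1 / 2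
        \<and> measure M {\<omega> \<in> space M. B i \<omega> = 1} = 1 / 2)
   \<and> prob_space.indep_vars M (\<lambda>_. borel) B {1..n}
   \<and> prob_space.indep_set M
        (sets (vimage_algebra (space M) (rvec n A) (\<Pi>\<^sub>M i\<in>{1..n}. borel)))
        (sets (vimage_algebra (space M) (rvec n B) (\<Pi>\<^sub>M i\<in>{1..n}. borel)))"

end

theory Submission
  imports Defs
begin

text \<open>The amplitude of \<open>|2j>\<close> is a multiple of the top-left entry of \<open>H R\<^sub>z(\<theta>) H\<close>, which is
  \<open>cos (\<theta> / 2)\<close>; hence \<open>2 P - 1/n = cos \<theta> / n\<close> and the network is the average of the \<open>n\<close> random
  features \<open>W\<^sub>j cos (2 \<pi> A\<^sub>j \<bullet> x + \<pi>/2 B\<^sub>j)\<close>. Choosing \<open>W\<^sub>j\<close> as twice the real part (if \<open>B\<^sub>j = 0\<close>) or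
  the imaginary part (if \<open>B\<^sub>j = 1\<close>) of the Fourier transform of \<open>f\<close>, divided by the sampling density
  at \<open>A\<^sub>j\<close>, Fourier inversion makes each feature an unbiased estimator of \<open>f x\<close>. Its second
  moment is at most twice the weighted energy and distinct features are uncorrelated, so the mean
  square error at every \<open>x\<close> is at most twice the weighted energy divided by \<open>n\<close>; Tonelli's theorem
  then handles the integral over \<open>x\<close>.\<close>

section \<open>Fourier inversion\<close>

lemma borel_measurable_cis [measurable (raw)]:
  "f \<in> borel_measurable M \<Longrightarrow> (\<lambda>x. cis (f x)) \<in> borel_measurable M"
  unfolding cis_conv_exp by measurable

text \<open>Lebesgue measure on a Euclidean space is the image of the product of one-dimensional
  Lebesgue measures under the coordinate map, so Fubini for finite products applies. This reduces
  the Gaussian integrals below to one variable.\<close>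

lemma
  fixes g :: "'a :: euclidean_space \<Rightarrow> real \<Rightarrow> 'b :: {real_normed_field,banach,second_countable_topology}"
  assumes "\<And>b. b \<in> Basis \<Longrightarrow> integrable lborel (g b)"
  shows integrable_lborel_prod: "integrable lborel (\<lambda>x::'a. \<Prod>b\<in>Basis. g b (inner x b))"
    and integral_lborel_prod:
      "(\<integral>x. (\<Prod>b\<in>Basis. g b (inner x b)) \<partial>(lborel :: 'a measure)) = (\<Prod>b\<in>Basis. \<integral>t. g b t \<partial>lborel)"
proof -
  interpret product_sigma_finite "\<lambda>_::'a. lborel :: real measure"
    by standard
  let ?T = "\<lambda>f. \<Sum>b\<in>Basis. f b *\<^sub>R b :: 'a"
  have T: "?T \<in> measurable (\<Pi>\<^sub>M b\<in>Basis. lborel) borel"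
    by measurable
  have gm [measurable]: "g b \<in> borel_measurable borel" if "b \<in> Basis" for b
    using assms[OF that] by auto
  have m: "(\<lambda>x::'a. \<Prod>b\<in>Basis. g b (inner x b)) \<in> borel_measurable borel"
    by measurable
  have eq: "(\<Prod>b\<in>Basis. g b (inner (?T f) b)) = (\<Prod>b\<in>Basis. g b (f b))" for f
    by (intro prod.cong refl) (simp add: inner_sum_left inner_Basis if_distrib sum.delta' cong: if_cong)
  show "integrable lborel (\<lambda>x::'a. \<Prod>b\<in>Basis. g b (inner x b))"
    by (subst lborel_eq, subst integrable_distr_eq[OF T m])
      (simp only: eq, rule product_integrable_prod, auto simp: assms)
  show "(\<integral>x. (\<Prod>b\<in>Basis. g b (inner x b)) \<partial>(lborel :: 'a measure)) = (\<Prod>b\<in>Basis. \<integral>t. g b t \<partial>lborel)"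
    by (subst lborel_eq, subst integral_distr[OF T m])
      (simp only: eq, rule product_integral_prod, auto simp: assms)
qed

text \<open>The integral is the characteristic function of the standard normal distribution, written
  out against its density.\<close>

lemma
  fixes t :: real
  shows integrable_cis_std_normal: "integrable lborel (\<lambda>u. complex_of_real (std_normal_density u) * cis (t * u))"
    and integral_cis_std_normal:
      "(\<integral>u. complex_of_real (std_normal_density u) * cis (t * u) \<partial>lborel) = complex_of_real (exp (- t\<^sup>2 / 2))"
proof -
  have "integrable lborel std_normal_density" by simp
  then show "integrable lborel (\<lambda>u. complex_of_real (std_normal_density u) * cis (t * u))"
    by (rule Bochner_Integration.integrable_bound) (auto simp: norm_mult)
  have "complex_of_real (exp (- t\<^sup>2 / 2)) = char std_normal_distribution t"
    by (simp add: char_std_normal_distribution)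
  also have "\<dots> = (\<integral>u. complex_of_real (std_normal_density u) * cis (t * u) \<partial>lborel)"
    unfolding char_def by (subst integral_density) (auto simp: cis_conv_exp scaleR_conv_of_real)
  finally show "(\<integral>u. complex_of_real (std_normal_density u) * cis (t * u) \<partial>lborel) = complex_of_real (exp (- t\<^sup>2 / 2))" ..
qed

text \<open>Up to the factor \<open>sqrt (2 * pi)\<close> the Gaussian is the standard normal
  density at \<open>s / k\<close>, so the substitution \<open>u = s / k\<close> reduces the claim to
  the previous lemma with frequency \<open>2 * pi * t * k\<close>. The resulting Gaussian in
  \<open>t\<close> is already normalised.\<close>

lemma
  fixes t k :: real
  assumes "k > 0"
  shows integrable_cis_gauss: "integrable lborel (\<lambda>s. complex_of_real (exp (- (s / k)\<^sup>2 / 2)) * cis (2 * pi * t * s))"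
    and integral_cis_gauss: "(\<integral>s. complex_of_real (exp (- (s / k)\<^sup>2 / 2)) * cis (2 * pi * t * s) \<partial>lborel)
      = complex_of_real (normal_density 0 (1 / (2 * pi * k)) t)"
proof -
  have eq: "complex_of_real (exp (- (s / k)\<^sup>2 / 2)) * cis (2 * pi * t * s) =
    complex_of_real (sqrt (2 * pi)) * (complex_of_real (std_normal_density (0 + (1 / k) * s)) * cis ((2 * pi * t * k) * (0 + (1 / k) * s)))" for s
    using assms by (simp add: std_normal_density_def field_simps flip: of_real_mult)
  have i: "integrable lborel (\<lambda>s. complex_of_real (std_normal_density (0 + (1 / k) * s)) * cis ((2 * pi * t * k) * (0 + (1 / k) * s)))"
    using assms by (intro lborel_integrable_real_affine integrable_cis_std_normal) auto
  then show "integrable lborel (\<lambda>s. complex_of_real (exp (- (s / k)\<^sup>2 / 2)) * cis (2 * pi * t * s))"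
    unfolding eq by simp
  \<comment> \<open>The trivial factor \<open>k * (1 / k)\<close> supplies the Jacobian
    \<open>1 / k\<close> of the substitution, and the argument is kept in the form
    \<open>0 + (1 / k) * s\<close> of an affine map.\<close>
  have "(\<integral>s. complex_of_real (std_normal_density (0 + (1 / k) * s)) * cis ((2 * pi * t * k) * (0 + (1 / k) * s)) \<partial>lborel)
     = k *\<^sub>R ((1/k) *\<^sub>R (\<integral>s. complex_of_real (std_normal_density (0 + (1 / k) * s)) * cis ((2 * pi * t * k) * (0 + (1 / k) * s)) \<partial>lborel))"
    using assms by simp
  also have "\<dots> = k *\<^sub>R (\<integral>u. complex_of_real (std_normal_density u) * cis ((2 * pi * t * k) * u) \<partial>lborel)"
    using assms by (subst (2) lborel_integral_real_affine[of "1/k" _ 0]) auto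
  also have "\<dots> = k *\<^sub>R complex_of_real (exp (- (2 * pi * t * k)\<^sup>2 / 2))"
    by (simp only: integral_cis_std_normal)
  finally have *: "(\<integral>s. complex_of_real (std_normal_density (0 + (1 / k) * s)) * cis ((2 * pi * t * k) * (0 + (1 / k) * s)) \<partial>lborel) = \<dots>" .
  have "sqrt (2 * pi) * k = 1 / sqrt (2 * pi * (1 / (2 * pi * k))\<^sup>2)"
    using assms by (simp add: real_sqrt_mult power2_eq_square real_sqrt_divide field_simps)
  moreover have "- (2 * pi * t * k)\<^sup>2 / 2 = - t\<^sup>2 / (2 * (1 / (2 * pi * k))\<^sup>2)"
    using assms by (simp add: power2_eq_square field_simps)
  ultimately have "sqrt (2 * pi) * k * exp (- (2 * pi * t * k)\<^sup>2 / 2) = normal_density 0 (1 / (2 * pi * k)) t"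
    unfolding normal_density_def by simp
  then show "(\<integral>s. complex_of_real (exp (- (s / k)\<^sup>2 / 2)) * cis (2 * pi * t * s) \<partial>lborel)
      = complex_of_real (normal_density 0 (1 / (2 * pi * k)) t)"
    unfolding eq integral_mult_right_zero * by (simp add: scaleR_conv_of_real mult.assoc flip: of_real_mult)
qed

text \<open>The Fourier transform of the Gaussian \<open>exp (- (norm \<xi> / k)\<^sup>2 / 2)\<close>; it concentrates at \<open>0\<close> as
  \<open>k\<close> tends to infinity.\<close>

definition heat_kernel :: "real \<Rightarrow> 'a :: euclidean_space \<Rightarrow> real" where
  "heat_kernel k z = (\<Prod>b\<in>Basis. normal_density 0 (1 / (2 * pi * k)) (inner z b))"

text \<open>The exponents of the one-dimensional densities add up to the squared norm. This radial
  form gives the bounds on the kernel.\<close>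

lemma heat_kernel_eq:
  fixes z :: "'a :: euclidean_space"
  assumes "k > 0"
  shows "heat_kernel k z = (sqrt (2 * pi) * k) ^ DIM('a) * exp (- 2 * pi\<^sup>2 * k\<^sup>2 * (norm z)\<^sup>2)"
proof -
  have "1 / sqrt (2 * pi * (1 / (2 * pi * k))\<^sup>2) = sqrt (2 * pi) * k"
    using assms by (simp add: real_sqrt_mult power2_eq_square real_sqrt_divide field_simps)
  moreover have "- t\<^sup>2 / (2 * (1 / (2 * pi * k))\<^sup>2) = - 2 * pi\<^sup>2 * k\<^sup>2 * t\<^sup>2" for t
    using assms by (simp add: power2_eq_square field_simps)
  ultimately have "normal_density 0 (1 / (2 * pi * k)) t = sqrt (2 * pi) * k * exp (- 2 * pi\<^sup>2 * k\<^sup>2 * t\<^sup>2)" for t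
    unfolding normal_density_def by simp
  moreover have "(norm z)\<^sup>2 = (\<Sum>b\<in>Basis. (inner z b)\<^sup>2)"
    unfolding power2_norm_eq_inner euclidean_inner[of z z] by (simp add: power2_eq_square)
  ultimately show ?thesis
    by (simp add: heat_kernel_def prod.distrib sum_distrib_left flip: exp_sum)
qed

text \<open>By symmetry of the normal density, the kernel in \<open>y\<close> is a product of normal
  densities centred at the coordinates of \<open>x\<close>, each of mass one.\<close>

lemma
  assumes "k > 0"
  shows integrable_heat_kernel: "integrable lborel (\<lambda>y. heat_kernel k (x - y :: 'a :: euclidean_space))"
    and integral_heat_kernel: "(\<integral>y. heat_kernel k (x - y :: 'a) \<partial>lborel) = 1"
proof -
  have eq: "heat_kernel k (x - y) = (\<Prod>b\<in>Basis. normal_density (inner x b) (1 / (2 * pi * k)) (inner y b))" for y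
    unfolding heat_kernel_def normal_density_def by (simp add: inner_diff_left power2_commute)
  show "integrable lborel (\<lambda>y. heat_kernel k (x - y :: 'a))"
    unfolding eq using assms by (intro integrable_lborel_prod) auto
  show "(\<integral>y. heat_kernel k (x - y :: 'a) \<partial>lborel) = 1"
    unfolding eq using assms by (subst integral_lborel_prod) auto
qed

text \<open>Both the Gaussian and the character split into factors over the coordinates, so the
  one-dimensional transform applies to each factor.\<close>

lemma
  fixes z :: "'a :: euclidean_space"
  assumes "k > 0"
  shows integrable_gauss_lborel: "integrable lborel (\<lambda>\<xi>. complex_of_real (exp (- (norm \<xi> / k)\<^sup>2 / 2)) * cis (2 * pi * inner z \<xi>))"
    and integral_gauss_lborel: "(\<integral>\<xi>. complex_of_real (exp (- (norm \<xi> / k)\<^sup>2 / 2)) * cis (2 * pi * inner z \<xi>) \<partial>lborel) = complex_of_real (heat_kernel k z)"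
proof -
  have eq: "complex_of_real (exp (- (norm \<xi> / k)\<^sup>2 / 2)) * cis (2 * pi * inner z \<xi>) =
    (\<Prod>b\<in>Basis. complex_of_real (exp (- (inner \<xi> b / k)\<^sup>2 / 2)) * cis (2 * pi * inner z b * inner \<xi> b))" for \<xi>
  proof -
    have "(norm \<xi>)\<^sup>2 = (\<Sum>b\<in>Basis. (inner \<xi> b)\<^sup>2)"
      unfolding power2_norm_eq_inner euclidean_inner[of \<xi> \<xi>] by (simp add: power2_eq_square)
    then have "- (norm \<xi> / k)\<^sup>2 / 2 = (\<Sum>b\<in>Basis. - (inner \<xi> b / k)\<^sup>2 / 2)"
      by (simp add: power_divide sum_negf flip: sum_divide_distrib)
    moreover have "cis (2 * pi * inner z \<xi>) = (\<Prod>b\<in>Basis. cis (2 * pi * inner z b * inner \<xi> b))"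
      by (simp add: cis_conv_exp euclidean_inner[of z \<xi>] sum_distrib_left mult.assoc flip: exp_sum)
    ultimately show ?thesis
      by (simp add: prod.distrib exp_sum)
  qed
  show "integrable lborel (\<lambda>\<xi>. complex_of_real (exp (- (norm \<xi> / k)\<^sup>2 / 2)) * cis (2 * pi * inner z \<xi>))"
    unfolding eq using assms by (intro integrable_lborel_prod integrable_cis_gauss)
  show "(\<integral>\<xi>. complex_of_real (exp (- (norm \<xi> / k)\<^sup>2 / 2)) * cis (2 * pi * inner z \<xi>) \<partial>lborel) = complex_of_real (heat_kernel k z)"
    unfolding eq
    by (subst integral_lborel_prod, rule integrable_cis_gauss[OF assms])
      (simp only: integral_cis_gauss[OF assms] heat_kernel_def of_real_prod)
qed


section \<open>The heat kernel as an approximate identity\<close>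

lemma heat_kernel_nonneg: "0 \<le> heat_kernel k z"
  unfolding heat_kernel_def by (intro prod_nonneg) auto

lemma heat_kernel_le:
  assumes "k > 0"
  shows "heat_kernel k (z :: 'a :: euclidean_space) \<le> (sqrt (2 * pi) * k) ^ DIM('a)"
  unfolding heat_kernel_eq[OF assms] using assms by (intro mult_left_le) auto

text \<open>The quotient of the kernels for \<open>k\<close> and for \<open>1\<close> is
  \<open>k ^ DIM('a)\<close> times a Gaussian that decreases in \<open>norm z\<close>, hence is
  largest at distance \<delta>. The kernel for \<open>1\<close> thus becomes an integrable majorant
  away from the origin, with a prefactor that vanishes as \<open>k\<close> grows.\<close>

lemma heat_kernel_tail_le:
  fixes z :: "'a :: euclidean_space"
  assumes "k \<ge> 1" "0 \<le> \<delta>" "\<delta> \<le> norm z"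
  shows "heat_kernel k z \<le> k ^ DIM('a) * exp (- 2 * pi\<^sup>2 * (k\<^sup>2 - 1) * \<delta>\<^sup>2) * heat_kernel 1 z"
proof -
  have "heat_kernel k z = k ^ DIM('a) * exp (- 2 * pi\<^sup>2 * (k\<^sup>2 - 1) * (norm z)\<^sup>2) * heat_kernel 1 z"
    using assms by (simp add: heat_kernel_eq power_mult_distrib algebra_simps flip: exp_add)
  also have "\<dots> \<le> k ^ DIM('a) * exp (- 2 * pi\<^sup>2 * (k\<^sup>2 - 1) * \<delta>\<^sup>2) * heat_kernel 1 z"
    using assms by (intro mult_right_mono mult_left_mono heat_kernel_nonneg)
      (auto intro!: mult_left_mono power_mono)
  finally show ?thesis .
qed

text \<open>For \<open>k \<ge> 1\<close> one has \<open>k \<le> k\<^sup>2\<close>, so the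
  exponential is at most \<open>exp (a - a * k)\<close>, which beats every power. The constant
  \<open>exp a / a ^ d\<close> accounts for the shift by \<open>a\<close> and for rescaling
  \<open>k\<close> to \<open>a * k\<close>.\<close>

lemma tendsto_power_mult_exp_neg_square:
  fixes a :: real
  assumes "a > 0"
  shows "((\<lambda>k. k ^ d * exp (- a * (k\<^sup>2 - 1))) \<longlongrightarrow> 0) at_top"
proof (rule tendsto_sandwich[OF _ _ tendsto_const])
  have "filterlim (\<lambda>k. a * k) at_top at_top"
    using assms by (intro filterlim_tendsto_pos_mult_at_top[OF tendsto_const _ filterlim_ident])
  then have "((\<lambda>k. (a * k) ^ d / exp (a * k)) \<longlongrightarrow> 0) at_top"
    by (rule filterlim_compose[OF tendsto_power_div_exp_0])
  from tendsto_mult_left[OF this, of "exp a / a ^ d"]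
  show "((\<lambda>k. exp a / a ^ d * ((a * k) ^ d / exp (a * k))) \<longlongrightarrow> 0) at_top" by simp
  show "\<forall>\<^sub>F k in at_top. 0 \<le> k ^ d * exp (- a * (k\<^sup>2 - 1))"
    using eventually_ge_at_top[of 0] by eventually_elim simp
  show "\<forall>\<^sub>F k in at_top. k ^ d * exp (- a * (k\<^sup>2 - 1)) \<le> exp a / a ^ d * ((a * k) ^ d / exp (a * k))"
    using eventually_ge_at_top[of 1]
  proof eventually_elim
    case (elim k)
    have "k * 1 \<le> k * k" using elim by (intro mult_left_mono) auto
    then have "a * k \<le> a * k\<^sup>2" using assms by (simp add: power2_eq_square)
    then have "exp (- a * (k\<^sup>2 - 1)) \<le> exp (a - a * k)" by (simp add: algebra_simps)
    then have "k ^ d * exp (- a * (k\<^sup>2 - 1)) \<le> k ^ d * exp (a - a * k)"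
      using elim by (intro mult_left_mono) auto
    then show ?case using assms by (simp add: exp_diff power_mult_distrib mult.commute)
  qed
qed

lemma heat_kernel_measurable [measurable (raw)]:
  "f \<in> borel_measurable M \<Longrightarrow> (\<lambda>x. heat_kernel k (f x :: 'a :: euclidean_space)) \<in> borel_measurable M"
  unfolding heat_kernel_def normal_density_def by measurable simp_all

lemma integrable_heat_kernel_mult:
  fixes f :: "'a :: euclidean_space \<Rightarrow> complex"
  assumes "k > 0" and f: "integrable lborel f"
  shows "integrable lborel (\<lambda>y. complex_of_real (heat_kernel k (x - y)) * f y)"
proof (rule Bochner_Integration.integrable_bound)
  show "integrable lborel (\<lambda>y. (sqrt (2 * pi) * k) ^ DIM('a) * norm (f y))"
    using f by auto
  have [measurable]: "f \<in> borel_measurable borel" using f by auto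
  show "(\<lambda>y. complex_of_real (heat_kernel k (x - y)) * f y) \<in> borel_measurable lborel"
    by measurable
  show "AE y in lborel. norm (complex_of_real (heat_kernel k (x - y)) * f y) \<le> norm ((sqrt (2 * pi) * k) ^ DIM('a) * norm (f y))"
    using assms(1) heat_kernel_le[OF assms(1)]
    by (intro AE_I2) (auto simp: norm_mult abs_mult heat_kernel_nonneg intro!: mult_right_mono)
qed

text \<open>The kernel has mass one, so the error is the integral of the kernel against
  \<open>f y - f x\<close>. Continuity controls it near \<open>x\<close> and the tail bound
  elsewhere; integrability of \<open>f\<close> replaces boundedness.\<close>

lemma heat_kernel_approx_identity:
  fixes f :: "'a :: euclidean_space \<Rightarrow> complex"
  assumes f: "integrable lborel f" and cont: "isCont f x"
  shows "((\<lambda>k. \<integral>y. complex_of_real (heat_kernel k (x - y)) * f y \<partial>lborel) \<longlongrightarrow> f x) at_top"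
proof (rule tendstoI)
  fix e :: real assume "e > 0"
  then obtain \<delta> where \<delta>: "\<delta> > 0" "\<And>y. dist y x < \<delta> \<Longrightarrow> dist (f y) (f x) < e / 2"
    using cont unfolding continuous_at_eps_delta by (metis half_gt_zero)
  \<comment> \<open>\<open>K\<close> is the integral of the bracket in the majorant
    \<open>?B\<close> below; \<open>c k\<close> is the prefactor of the tail bound at distance
    \<delta>.\<close>
  define K where "K = (sqrt (2 * pi)) ^ DIM('a) * (\<integral>y. norm (f y) \<partial>lborel) + norm (f x)"
  define c where "c = (\<lambda>k. k ^ DIM('a) * exp (- (2 * pi\<^sup>2 * \<delta>\<^sup>2) * (k\<^sup>2 - 1)))"
  have "(c \<longlongrightarrow> 0) at_top"
    unfolding c_def using \<delta>(1) by (intro tendsto_power_mult_exp_neg_square) simp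
  from tendsto_mult_left[OF this, of K] have "((\<lambda>k. K * c k) \<longlongrightarrow> 0) at_top" by simp
  from order_tendstoD(2)[OF this, of "e / 2"] \<open>e > 0\<close>
  have "\<forall>\<^sub>F k in at_top. K * c k < e / 2" by simp
  then show "\<forall>\<^sub>F k in at_top. dist (\<integral>y. complex_of_real (heat_kernel k (x - y)) * f y \<partial>lborel) (f x) < e"
    using eventually_ge_at_top[of 1]
  proof eventually_elim
    case (elim k)
    then have "k > 0" by simp
    note int = integrable_heat_kernel[OF \<open>k > 0\<close>, of x] integrable_heat_kernel[of 1 x, simplified]
      integrable_heat_kernel_mult[OF \<open>k > 0\<close> f, of x]
    have [measurable]: "f \<in> borel_measurable borel" using f by auto
    have ci: "integrable lborel (\<lambda>y. complex_of_real (heat_kernel k (x - y)) * f x)"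
      using int(1) by auto
    \<comment> \<open>The first summand dominates for \<open>dist y x < \<delta>\<close>, the second
      otherwise. Adding both gives one majorant on the whole space and avoids splitting the
      integral.\<close>
    let ?B = "\<lambda>y. e / 2 * heat_kernel k (x - y) + c k * ((sqrt (2 * pi)) ^ DIM('a) * norm (f y) + norm (f x) * heat_kernel 1 (x - y))"
    have iB: "integrable lborel ?B"
      using int(1,2) f by auto
    have pt: "norm (complex_of_real (heat_kernel k (x - y)) * f y - complex_of_real (heat_kernel k (x - y)) * f x) \<le> ?B y" for y
    proof -
      have ck: "0 \<le> c k" using elim by (simp add: c_def)
      have hB: "0 \<le> (sqrt (2 * pi)) ^ DIM('a) * norm (f y) + norm (f x) * heat_kernel 1 (x - y)"
        by (intro add_nonneg_nonneg mult_nonneg_nonneg heat_kernel_nonneg) auto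
      have eq: "norm (complex_of_real (heat_kernel k (x - y)) * f y - complex_of_real (heat_kernel k (x - y)) * f x) = heat_kernel k (x - y) * norm (f y - f x)"
        by (simp add: heat_kernel_nonneg norm_mult flip: right_diff_distrib)
      show ?thesis
      proof (cases "dist y x < \<delta>")
        case True
        have "heat_kernel k (x - y) * norm (f y - f x) \<le> heat_kernel k (x - y) * (e / 2)"
          using \<delta>(2)[OF True] by (intro mult_left_mono heat_kernel_nonneg) (auto simp: dist_norm)
        then show ?thesis unfolding eq using mult_nonneg_nonneg[OF ck hB] by (simp add: mult.commute)
      next
        case False
        then have "heat_kernel k (x - y) \<le> c k * heat_kernel 1 (x - y)"
          using heat_kernel_tail_le[of k \<delta> "x - y"] elim \<delta>(1)
          by (simp add: c_def dist_norm norm_minus_commute mult_ac)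
        then have "heat_kernel k (x - y) * norm (f y - f x) \<le> c k * heat_kernel 1 (x - y) * (norm (f y) + norm (f x))"
          using ck by (intro mult_mono norm_triangle_ineq4 mult_nonneg_nonneg heat_kernel_nonneg) auto
        \<comment> \<open>Beside \<open>norm (f y)\<close> the kernel is replaced by its supremum;
          beside the constant \<open>norm (f x)\<close> it must stay, since a constant is not
          integrable.\<close>
        also have "\<dots> \<le> c k * ((sqrt (2 * pi)) ^ DIM('a) * norm (f y) + norm (f x) * heat_kernel 1 (x - y))"
          using heat_kernel_le[of 1 "x - y"] mult_right_mono[OF heat_kernel_le[of 1 "x - y"], of "norm (f y)"] ck
          by (simp only: mult.assoc, intro mult_left_mono) (simp_all add: algebra_simps)
        finally show ?thesis unfolding eq
          using mult_nonneg_nonneg[OF _ heat_kernel_nonneg, of "e / 2" k "x - y"] \<open>e > 0\<close> by simp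
      qed
    qed
    have fx: "(\<integral>y. complex_of_real (heat_kernel k (x - y)) * f x \<partial>lborel) = f x"
      using integral_heat_kernel[OF \<open>k > 0\<close>, of x] by simp
    have "dist (\<integral>y. complex_of_real (heat_kernel k (x - y)) * f y \<partial>lborel) (f x) =
      norm (\<integral>y. complex_of_real (heat_kernel k (x - y)) * f y - complex_of_real (heat_kernel k (x - y)) * f x \<partial>lborel)"
      unfolding Bochner_Integration.integral_diff[OF int(3) ci] fx by (simp add: dist_norm)
    also have "\<dots> \<le> (\<integral>y. ?B y \<partial>lborel)"
      by (intro Bochner_Integration.integral_norm_bound_integral iB pt Bochner_Integration.integrable_diff int(3) ci)
    also have "\<dots> = e / 2 + c k * K"
      using int(1,2) f integral_heat_kernel[OF \<open>k > 0\<close>, of x] integral_heat_kernel[of 1 x]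
      by (simp add: K_def)
    also have "\<dots> < e" using elim by (simp add: mult.commute)
    finally show ?case .
  qed
qed

text \<open>A Gaussian factor of width \<open>k\<close> is inserted and the limit at infinity is
  taken in two ways. Dominated convergence with majorant \<open>norm (F \<xi>)\<close> recovers the
  inversion integral, while Fubini turns the same expression into a convolution of \<open>f\<close>
  with the heat kernel, which tends to \<open>f x\<close>.\<close>

theorem fourier_inversion:
  fixes f :: "'a :: euclidean_space \<Rightarrow> complex"
  defines "F \<equiv> \<lambda>\<xi>. \<integral>y. cis (- 2 * pi * inner y \<xi>) * f y \<partial>lborel"
  assumes f: "integrable lborel f" and F: "integrable lborel F" and cont: "isCont f x"
  shows "(\<integral>\<xi>. F \<xi> * cis (2 * pi * inner x \<xi>) \<partial>lborel) = f x"
proof -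
  have [measurable]: "f \<in> borel_measurable borel" "F \<in> borel_measurable borel"
    using f F by auto
  let ?G = "\<lambda>k \<xi>. complex_of_real (exp (- (norm (\<xi> :: 'a) / k)\<^sup>2 / 2))"
  have smoothed: "(\<integral>\<xi>. ?G k \<xi> * (F \<xi> * cis (2 * pi * inner x \<xi>)) \<partial>lborel) =
    (\<integral>y. complex_of_real (heat_kernel k (x - y)) * f y \<partial>lborel)" if "k > 0" for k
  proof -
    let ?h = "\<lambda>y \<xi>. (?G k \<xi> * cis (2 * pi * inner (x - y) \<xi>)) * f y"
    have inner_int: "(\<integral>y. ?h y \<xi> \<partial>lborel) = ?G k \<xi> * (F \<xi> * cis (2 * pi * inner x \<xi>))" for \<xi>
    proof -
      have "?h y \<xi> = (?G k \<xi> * cis (2 * pi * inner x \<xi>)) * (cis (- 2 * pi * inner y \<xi>) * f y)" for y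
        by (simp add: inner_diff_left cis_mult algebra_simps)
      then have "(\<integral>y. ?h y \<xi> \<partial>lborel) = (?G k \<xi> * cis (2 * pi * inner x \<xi>)) * F \<xi>"
        unfolding F_def by (simp only: integral_mult_right_zero)
      then show ?thesis by (simp add: mult_ac)
    qed
    \<comment> \<open>This is the purpose of the Gaussian: the norm of the integrand is
      \<open>norm (f y)\<close> times an integrable function of \<xi>, whereas without it there
      would be no decay in \<xi>.\<close>
    have "integrable (lborel \<Otimes>\<^sub>M lborel) (case_prod ?h)"
    proof (rule lborel_pair.Fubini_integrable)
      show "case_prod ?h \<in> borel_measurable (lborel \<Otimes>\<^sub>M lborel)" by measurable
      have "integrable lborel (\<lambda>\<xi>::'a. exp (- (norm \<xi> / k)\<^sup>2 / 2))"
        using integrable_norm[OF integrable_gauss_lborel[OF that, of 0]] by (simp add: norm_mult)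
      then show "integrable lborel (\<lambda>y. \<integral>\<xi>. norm (case_prod ?h (y, \<xi>)) \<partial>lborel)"
        using f by (simp add: norm_mult)
      show "AE y in lborel. integrable lborel (\<lambda>\<xi>. case_prod ?h (y, \<xi>))"
        unfolding prod.case by (intro AE_I2 integrable_mult_left integrable_gauss_lborel that)
    qed
    then have swap: "(\<integral>\<xi>. (\<integral>y. ?h y \<xi> \<partial>lborel) \<partial>lborel) = (\<integral>y. (\<integral>\<xi>. ?h y \<xi> \<partial>lborel) \<partial>lborel)"
      by (rule lborel_pair.Fubini_integral)
    have "(\<integral>\<xi>. ?G k \<xi> * (F \<xi> * cis (2 * pi * inner x \<xi>)) \<partial>lborel) = (\<integral>\<xi>. (\<integral>y. ?h y \<xi> \<partial>lborel) \<partial>lborel)"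
      by (intro Bochner_Integration.integral_cong refl inner_int[symmetric])
    also note swap
    also have "(\<integral>y. (\<integral>\<xi>. ?h y \<xi> \<partial>lborel) \<partial>lborel) = (\<integral>y. complex_of_real (heat_kernel k (x - y)) * f y \<partial>lborel)"
      by (simp only: integral_mult_left_zero integral_gauss_lborel[OF that])
    finally show ?thesis .
  qed
  have "((\<lambda>k. \<integral>\<xi>. ?G k \<xi> * (F \<xi> * cis (2 * pi * inner x \<xi>)) \<partial>lborel) \<longlongrightarrow>
    (\<integral>\<xi>. F \<xi> * cis (2 * pi * inner x \<xi>) \<partial>lborel)) at_top"
  proof (rule integral_dominated_convergence_at_top)
    show "integrable lborel (\<lambda>\<xi>. norm (F \<xi>))" using F by auto
    have lim: "((\<lambda>k. norm \<xi> / k) \<longlongrightarrow> 0) at_top" for \<xi> :: 'a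
      by (rule real_tendsto_divide_at_top[OF tendsto_const filterlim_ident])
    have "((\<lambda>k. ?G k \<xi> * (F \<xi> * cis (2 * pi * inner x \<xi>))) \<longlongrightarrow> complex_of_real (exp (- (0\<^sup>2) / 2)) * (F \<xi> * cis (2 * pi * inner x \<xi>))) at_top" for \<xi>
      by (intro tendsto_intros lim) simp
    then show "AE \<xi> in lborel. ((\<lambda>k. ?G k \<xi> * (F \<xi> * cis (2 * pi * inner x \<xi>))) \<longlongrightarrow> F \<xi> * cis (2 * pi * inner x \<xi>)) at_top"
      by simp
    show "\<forall>\<^sub>F k in at_top. AE \<xi> in lborel. norm (?G k \<xi> * (F \<xi> * cis (2 * pi * inner x \<xi>))) \<le> norm (F \<xi>)"
      by (intro always_eventually allI AE_I2) (simp add: norm_mult mult_left_le_one_le)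
  qed measurable
  moreover have "((\<lambda>k. \<integral>\<xi>. ?G k \<xi> * (F \<xi> * cis (2 * pi * inner x \<xi>)) \<partial>lborel) \<longlongrightarrow> f x) at_top"
    by (rule Lim_transform_eventually[OF heat_kernel_approx_identity[OF f cont]
          eventually_mono[OF eventually_gt_at_top smoothed[symmetric]]])
  ultimately show ?thesis
    by (rule tendsto_unique[OF trivial_limit_at_top_linorder])
qed

section \<open>The output of the circuit\<close>

text \<open>All leading blocks have size two, so row \<open>2 * i\<close> is the first row of block
  \<open>i\<close>. The list \<open>Bs\<close> makes room for the identity block that pads the
  dimension to a power of two.\<close>

lemma index_diag_block_mat_2:
  assumes "\<And>X. X \<in> set As \<Longrightarrow> X \<in> carrier_mat 2 2"
    and "i < length As" "j < length As"
  shows "diag_block_mat (As @ Bs) $$ (2 * i, 2 * j) = (if i = j then (As ! i) $$ (0, 0) else 0)"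
  using assms
proof (induction As arbitrary: i j)
  case (Cons X As)
  have X: "dim_row X = 2" "dim_col X = 2" using Cons.prems(1)[of X] by auto
  have "map dim_row As = map (\<lambda>_. 2) As" "map dim_col As = map (\<lambda>_. 2) As"
    using Cons.prems(1) by auto
  then have "sum_list (map dim_row As) = 2 * length As" "sum_list (map dim_col As) = 2 * length As"
    by (simp_all only: sum_list_triv) simp_all
  \<comment> \<open>Lower bounds suffice to place the shifted indices inside the lower right block,
    whatever the sizes of the blocks in \<open>Bs\<close>.\<close>
  then have d: "dim_row (diag_block_mat (As @ Bs)) \<ge> 2 * length As" "dim_col (diag_block_mat (As @ Bs)) \<ge> 2 * length As"
    by (simp_all add: dim_diag_block_mat)
  show ?case
  proof (cases i; cases j)
    fix i' j' assume [simp]: "i = Suc i'" "j = Suc j'"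
    have "diag_block_mat (As @ Bs) $$ (2 * i', 2 * j') = (if i' = j' then (As ! i') $$ (0, 0) else 0)"
      using Cons.prems by (intro Cons.IH) auto
    then show ?thesis using Cons.prems d X by (simp add: Let_def)
  qed (use Cons.prems d X in \<open>auto simp: Let_def\<close>)
qed simp

section \<open>The rotation gates and the amplitudes\<close>

lemma Rz_carrier [simp]: "Rz \<alpha> \<in> carrier_mat 2 2"
  unfolding Rz_def mat_of_rows_list_def by (rule carrier_matI) simp_all

lemma hadamard_carrier [simp]: "hadamard \<in> carrier_mat 2 2"
  unfolding hadamard_def mat_of_rows_list_def by (rule carrier_matI) simp_all

lemma Rz_mult: "Rz \<alpha> * Rz \<beta> = Rz (\<alpha> + \<beta>)"
  by (rule eq_matI)
    (auto simp: Rz_def mat_of_rows_list_def scalar_prod_def numeral_2_eq_2 less_Suc_eq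
      algebra_simps diff_divide_distrib add_divide_distrib simp flip: exp_add)

text \<open>Diagonal rotations multiply by adding their angles. The start matrix \<open>X\<close> is
  arbitrary because each step of the fold changes it.\<close>

lemma fold_Rz_mult:
  assumes "X \<in> carrier_mat 2 2"
  shows "fold (\<lambda>j Y. Rz (c j) * Y) js X = Rz (\<Sum>j\<leftarrow>js. c j) * X"
  using assms
proof (induction js arbitrary: X)
  case Nil
  have "Rz 0 = 1\<^sub>m 2"
    by (rule eq_matI) (auto simp: Rz_def mat_of_rows_list_def numeral_2_eq_2 less_Suc_eq)
  then show ?case using Nil by simp
next
  case (Cons a js)
  have "Rz (c a) * X \<in> carrier_mat 2 2"
    using Cons.prems by (intro mult_carrier_mat[of _ 2 2]) auto
  then have "fold (\<lambda>j Y. Rz (c j) * Y) (a # js) X = Rz (\<Sum>j\<leftarrow>js. c j) * (Rz (c a) * X)"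
    using Cons.IH by simp
  also have "\<dots> = Rz (\<Sum>j\<leftarrow>js. c j) * Rz (c a) * X"
    by (rule assoc_mult_mat[symmetric, OF Rz_carrier Rz_carrier Cons.prems])
  finally show ?case by (simp add: Rz_mult add.commute)
qed

text \<open>Conjugation by the Hadamard matrix puts the average of the two diagonal entries, which
  are conjugate phases, in the corner.\<close>

lemma hadamard_Rz_hadamard_00: "(hadamard * (Rz \<theta> * hadamard)) $$ (0, 0) = complex_of_real (cos (\<theta> / 2))"
proof -
  have "complex_of_real (cos (\<theta> / 2)) = (exp (\<i> * (\<theta> / 2)) + exp (- \<i> * (\<theta> / 2))) / 2"
    by (simp add: cos_of_real[symmetric] cos_exp_eq)
  moreover have "complex_of_real (sqrt 2) * complex_of_real (sqrt 2) = 2"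
    by (simp flip: of_real_mult)
  ultimately show ?thesis
    by (simp add: hadamard_def Rz_def mat_of_rows_list_def scalar_prod_def numeral_2_eq_2 field_simps)
qed

text \<open>All rotations merge into one with angle
  \<open>- (pi / 2) * b - 2 * pi * inner a x\<close>; halving it and evenness of the cosine give the
  entry.\<close>

lemma
  fixes a x :: "real ^ 'd::{finite,linorder}"
  shows U1_carrier: "U1 a b x \<in> carrier_mat 2 2"
    and U1_00: "U1 a b x $$ (0, 0) = complex_of_real (cos (pi * inner a x + pi / 4 * b))"
proof -
  have "(\<Sum>j\<leftarrow>sorted_list_of_set UNIV. - 2 * pi * vec_nth a j * vec_nth x j) = - 2 * pi * inner a x"
    by (simp add: sum_list_distinct_conv_sum_set inner_vec_def sum_distrib_left mult.assoc)
  then have "U1 a b x = hadamard * (Rz (- (pi / 2) * b) * (Rz (- 2 * pi * inner a x) * hadamard))"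
    unfolding U1_def by (subst fold_Rz_mult) simp_all
  also have "\<dots> = hadamard * (Rz (- (pi / 2) * b + (- 2 * pi * inner a x)) * hadamard)"
    by (subst assoc_mult_mat[symmetric, OF Rz_carrier Rz_carrier hadamard_carrier]) (simp add: Rz_mult)
  finally have eq: "U1 a b x = hadamard * (Rz (- (pi / 2) * b + (- 2 * pi * inner a x)) * hadamard)" .
  show "U1 a b x \<in> carrier_mat 2 2"
    unfolding eq by (auto intro!: mult_carrier_mat[of _ 2 2 _ 2])
  have "(- (pi / 2) * b + (- 2 * pi * inner a x)) / 2 = - (pi * inner a x + pi / 4 * b)"
    by (simp add: field_simps)
  then show "U1 a b x $$ (0, 0) = complex_of_real (cos (pi * inner a x + pi / 4 * b))"
    unfolding eq hadamard_Rz_hadamard_00 by (simp only: cos_minus)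
qed

lemma Ubar_carrier: "Ubar n a b x \<in> carrier_mat (Nbar n) (Nbar n)"
proof -
  have "dim_row (U1 (a i) (b i) x) = 2" "dim_col (U1 (a i) (b i) x) = 2" for i
    using U1_carrier[of "a i" "b i" x] by auto
  then show ?thesis
    unfolding Ubar_def Nbar_def
    by (intro carrier_matI) (simp_all add: dim_diag_block_mat comp_def sum_list_const_mult sum_list_triv)
qed

text \<open>Parameters are numbered from \<open>1\<close> and matrix blocks from \<open>0\<close>,
  hence the shift to \<open>Suc i\<close>.\<close>

lemma Ubar_even_even:
  assumes "i < n" "j < n"
  shows "Ubar n a b x $$ (2 * i, 2 * j) =
    (if i = j then complex_of_real (cos (pi * inner (a (Suc i)) x + pi / 4 * b (Suc i))) else 0)"
proof -
  have "Ubar n a b x $$ (2 * i, 2 * j) =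
    (if i = j then (map (\<lambda>i. U1 (a i) (b i) x) [1..<Suc n] ! i) $$ (0, 0) else 0)"
    unfolding Ubar_def using assms by (intro index_diag_block_mat_2) (auto simp: U1_carrier simp del: upt_Suc)
  then show ?thesis using assms by (simp add: U1_00 del: upt_Suc)
qed

text \<open>The prepared state is spread evenly over the even basis vectors, and the block structure
  lets only the one with index \<open>2 * j\<close> contribute to the amplitude at
  \<open>2 * j\<close>.\<close>

lemma Pbar_even:
  assumes "state_prep n V" "j < n"
  shows "Pbar n V a b (2 * j) x = (cos (pi * inner (a (Suc j)) x + pi / 4 * b (Suc j)))\<^sup>2 / real n"
proof -
  let ?N = "Nbar n" and ?c = "complex_of_real (1 / sqrt (real n))"
  define \<psi> where "\<psi> = finsum_vec TYPE(complex) ?N (\<lambda>i. unit_vec ?N (2 * i)) {0..<n}"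
  have \<psi>: "\<psi> \<in> carrier_vec ?N"
    unfolding \<psi>_def by (intro finsum_vec_closed) auto
  have N: "2 * i < ?N" if "i < n" for i using that by (simp add: Nbar_def)
  note U = Ubar_carrier[of n a b x]
  have "\<psi> $ k = (\<Sum>i=0..<n. if k = 2 * i then 1 else 0)" if "k < ?N" for k
    unfolding \<psi>_def using that N by (subst index_finsum_vec) (auto intro!: sum.cong)
  then have "(Ubar n a b x *\<^sub>v \<psi>) $ (2 * j) = (\<Sum>k=0..<?N. Ubar n a b x $$ (2 * j, k) * (\<Sum>i=0..<n. if k = 2 * i then 1 else 0))"
    using U \<psi> N[OF assms(2)] by (auto simp: scalar_prod_def intro!: sum.cong)
  also have "\<dots> = (\<Sum>i=0..<n. \<Sum>k=0..<?N. if k = 2 * i then Ubar n a b x $$ (2 * j, k) else 0)"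
    by (subst sum.swap) (auto simp: sum_distrib_left intro!: sum.cong)
  also have "\<dots> = (\<Sum>i=0..<n. Ubar n a b x $$ (2 * j, 2 * i))"
    using N by (intro sum.cong refl) simp
  also have "\<dots> = (\<Sum>i=0..<n. if j = i then complex_of_real (cos (pi * inner (a (Suc j)) x + pi / 4 * b (Suc j))) else 0)"
    using assms(2) by (intro sum.cong refl) (simp add: Ubar_even_even)
  also have "\<dots> = complex_of_real (cos (pi * inner (a (Suc j)) x + pi / 4 * b (Suc j)))"
    using assms(2) by simp
  finally have amp: "(Ubar n a b x *\<^sub>v \<psi>) $ (2 * j) = \<dots>" .
  have "V *\<^sub>v unit_vec ?N 0 = ?c \<cdot>\<^sub>v \<psi>"
    using assms(1) by (simp add: state_prep_def \<psi>_def)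
  then have "Ubar n a b x *\<^sub>v (V *\<^sub>v unit_vec ?N 0) = ?c \<cdot>\<^sub>v (Ubar n a b x *\<^sub>v \<psi>)"
    using mult_mat_vec[OF U \<psi>] by simp
  moreover have "conjugate (unit_vec ?N (2 * j)) = (unit_vec ?N (2 * j) :: complex vec)"
    by (rule eq_vecI) (auto simp: unit_vec_def)
  moreover have "Ubar n a b x *\<^sub>v \<psi> \<in> carrier_vec ?N" using U \<psi> by simp
  ultimately have "(Ubar n a b x *\<^sub>v (V *\<^sub>v unit_vec ?N 0)) \<bullet>c unit_vec ?N (2 * j) =
    ?c * complex_of_real (cos (pi * inner (a (Suc j)) x + pi / 4 * b (Suc j)))"
    using N[OF assms(2)] U \<psi> by (simp add: amp scalar_prod_right_unit del: index_mult_mat_vec)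
  then show ?thesis
    by (simp add: Pbar_def norm_mult norm_divide power_mult_distrib power_divide)
qed

text \<open>Doubling and centring the probability turns the squared cosine into the cosine of the
  double angle.\<close>

lemma qrnn_eq:
  assumes "state_prep n V"
  shows "qrnn n V a b w x = (\<Sum>j=0..<n. w j * cos (2 * pi * inner (a (Suc j)) x + pi / 2 * b (Suc j))) / real n"
proof -
  have "2 * Pbar n V a b (2 * j) x - 1 / real n = cos (2 * pi * inner (a (Suc j)) x + pi / 2 * b (Suc j)) / real n" if "j < n" for j
  proof -
    have "cos (2 * pi * inner (a (Suc j)) x + pi / 2 * b (Suc j)) = 2 * (cos (pi * inner (a (Suc j)) x + pi / 4 * b (Suc j)))\<^sup>2 - 1"
      by (subst cos_double_cos[symmetric]) (simp add: algebra_simps)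
    then show ?thesis using that by (simp add: Pbar_even[OF assms] diff_divide_distrib)
  qed
  then show ?thesis
    unfolding qrnn_def by (simp add: sum_divide_distrib)
qed

section \<open>Averages of uncorrelated random features\<close>

lemma square_integrable_mult:
  fixes X Y :: "'w \<Rightarrow> real"
  assumes [measurable]: "X \<in> borel_measurable M" "Y \<in> borel_measurable M"
    and "integrable M (\<lambda>\<omega>. (X \<omega>)\<^sup>2)" "integrable M (\<lambda>\<omega>. (Y \<omega>)\<^sup>2)"
  shows "integrable M (\<lambda>\<omega>. X \<omega> * Y \<omega>)"
proof (rule Bochner_Integration.integrable_bound)
  show "integrable M (\<lambda>\<omega>. (X \<omega>)\<^sup>2 + (Y \<omega>)\<^sup>2)"
    using assms by auto
  have "\<bar>a * b\<bar> \<le> a\<^sup>2 + b\<^sup>2" for a b :: real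
    using sum_squares_bound[of "\<bar>a\<bar>" "\<bar>b\<bar>"] abs_ge_zero[of "a * b"] unfolding abs_mult power2_abs by linarith
  then show "AE \<omega> in M. norm (X \<omega> * Y \<omega>) \<le> norm ((X \<omega>)\<^sup>2 + (Y \<omega>)\<^sup>2)"
    by (intro AE_I2) simp
qed measurable

text \<open>The squared error is a double sum of covariances over \<open>(card I)\<^sup>2\<close>.
  Only the \<open>card I\<close> diagonal terms survive, each equal to the variance
  \<open>s - m\<^sup>2\<close>.\<close>

lemma (in prob_space)
  fixes X :: "'i \<Rightarrow> 'a \<Rightarrow> real"
  assumes I: "finite I" "I \<noteq> {}"
    and X [measurable]: "\<And>i. i \<in> I \<Longrightarrow> X i \<in> borel_measurable M"
    and sq: "\<And>i. i \<in> I \<Longrightarrow> integrable M (\<lambda>\<omega>. (X i \<omega>)\<^sup>2)"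
    and mean: "\<And>i. i \<in> I \<Longrightarrow> expectation (X i) = m"
    and second: "\<And>i. i \<in> I \<Longrightarrow> expectation (\<lambda>\<omega>. (X i \<omega>)\<^sup>2) = s"
    and uncorr: "\<And>i j. i \<in> I \<Longrightarrow> j \<in> I \<Longrightarrow> i \<noteq> j \<Longrightarrow> expectation (\<lambda>\<omega>. X i \<omega> * X j \<omega>) = m * m"
  shows integrable_sample_mean_error: "integrable M (\<lambda>\<omega>. ((\<Sum>i\<in>I. X i \<omega>) / card I - m)\<^sup>2)"
    and expectation_sample_mean_error: "expectation (\<lambda>\<omega>. ((\<Sum>i\<in>I. X i \<omega>) / card I - m)\<^sup>2) = (s - m\<^sup>2) / card I"
proof -
  let ?D = "\<lambda>i j \<omega>. (X i \<omega> - m) * (X j \<omega> - m)"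
  have eq: "((\<Sum>i\<in>I. X i \<omega>) / card I - m)\<^sup>2 = (\<Sum>i\<in>I. \<Sum>j\<in>I. ?D i j \<omega>) / (card I)\<^sup>2" for \<omega>
  proof -
    have "(\<Sum>i\<in>I. X i \<omega>) / card I - m = (\<Sum>i\<in>I. X i \<omega> - m) / card I"
      using I by (simp add: sum_subtractf diff_divide_distrib)
    then show ?thesis
      by (simp add: power_divide power2_eq_square sum_product)
  qed
  have int: "integrable M (X i)" if "i \<in> I" for i
    using square_integrable_imp_integrable[OF X[OF that] sq[OF that]] .
  have prod: "integrable M (\<lambda>\<omega>. X i \<omega> * X j \<omega>)" if "i \<in> I" "j \<in> I" for i j
    using that by (intro square_integrable_mult X sq)
  have D: "?D i j \<omega> = X i \<omega> * X j \<omega> - m * X i \<omega> - m * X j \<omega> + m * m" for i j \<omega>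
    by (simp add: algebra_simps)
  have intD: "integrable M (?D i j)" if "i \<in> I" "j \<in> I" for i j
    unfolding D using int prod that by auto
  have ED: "expectation (?D i j) = (if i = j then s - m\<^sup>2 else 0)" if "i \<in> I" "j \<in> I" for i j
  proof -
    have "expectation (?D i j) = expectation (\<lambda>\<omega>. X i \<omega> * X j \<omega>) - m * m - m * m + m * m"
      unfolding D using int prod that by (simp add: mean prob_space)
    also have "\<dots> = (if i = j then s - m\<^sup>2 else 0)"
      using that uncorr[of i j] second[of i] by (auto simp: power2_eq_square)
    finally show ?thesis .
  qed
  show "integrable M (\<lambda>\<omega>. ((\<Sum>i\<in>I. X i \<omega>) / card I - m)\<^sup>2)"
    unfolding eq using intD by (intro integrable_divide Bochner_Integration.integrable_sum) auto
  have "expectation (\<lambda>\<omega>. ((\<Sum>i\<in>I. X i \<omega>) / card I - m)\<^sup>2) = (\<Sum>i\<in>I. \<Sum>j\<in>I. if i = j then s - m\<^sup>2 else 0) / (card I)\<^sup>2"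
    unfolding eq using intD by (simp add: ED cong: sum.cong)
  also have "\<dots> = (s - m\<^sup>2) / card I"
    using I by (simp add: power2_eq_square)
  finally show "expectation (\<lambda>\<omega>. ((\<Sum>i\<in>I. X i \<omega>) / card I - m)\<^sup>2) = (s - m\<^sup>2) / card I" .
qed

lemma sum_zero_one: "(\<Sum>b\<in>{0, 1 :: real}. \<phi> b) = \<phi> 0 + \<phi> 1"
  by simp

text \<open>A measurable function of \<open>g\<close> generates no more events than \<open>g\<close>
  itself. This carries the assumed independence of generated algebras over to functions of the
  random vectors.\<close>

lemma sets_vimage_algebra_compose:
  assumes "g \<in> S \<rightarrow> space N" "\<phi> \<in> measurable N L"
  shows "sigma_sets S {(\<lambda>\<omega>. \<phi> (g \<omega>)) -` T \<inter> S |T. T \<in> sets L} \<subseteq> sets (vimage_algebra S g N)"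
proof -
  have m: "(\<lambda>\<omega>. \<phi> (g \<omega>)) \<in> measurable (vimage_algebra S g N) L"
    using assms by (intro measurable_compose[OF measurable_vimage_algebra1])
  have "{(\<lambda>\<omega>. \<phi> (g \<omega>)) -` T \<inter> S |T. T \<in> sets L} \<subseteq> sets (vimage_algebra S g N)"
    using measurable_sets[OF m] by auto
  from sets.sigma_sets_subset[OF this] show ?thesis by simp
qed

section \<open>Factorisation of expectations of the random parameters\<close>

context prob_space
begin

lemma rvec_measurable:
  assumes "\<And>i. i \<in> {1..n} \<Longrightarrow> X i \<in> measurable M N"
  shows "rvec n X \<in> measurable M (\<Pi>\<^sub>M i\<in>{1..n}. N)"
  unfolding rvec_def using assms by (intro measurable_restrict) auto

lemma random_params_measurable:
  assumes "random_params M n p A B" "i \<in> {1..n}"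
  shows "A i \<in> borel_measurable M" "B i \<in> borel_measurable M"
proof -
  have "A i \<in> measurable M lborel"
    using assms unfolding random_params_def by (intro distributed_measurable) auto
  then show "A i \<in> borel_measurable M" by simp
  show "B i \<in> borel_measurable M"
    using assms unfolding random_params_def by auto
qed

text \<open>Functions of \<open>A\<close> alone and of \<open>B\<close> alone generate subalgebras
  of the two algebras whose independence is assumed.\<close>

lemma indep_var_random_params:
  assumes rp: "random_params M n p A B"
    and \<phi>: "\<phi> \<in> measurable (\<Pi>\<^sub>M i\<in>{1..n}. borel) S" and \<psi>: "\<psi> \<in> measurable (\<Pi>\<^sub>M i\<in>{1..n}. borel) T"
  shows "indep_var S (\<lambda>\<omega>. \<phi> (rvec n A \<omega>)) T (\<lambda>\<omega>. \<psi> (rvec n B \<omega>))"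
proof -
  have A: "rvec n A \<in> measurable M (\<Pi>\<^sub>M i\<in>{1..n}. borel)" and B: "rvec n B \<in> measurable M (\<Pi>\<^sub>M i\<in>{1..n}. borel)"
    by (intro rvec_measurable random_params_measurable[OF rp]; assumption)+
  have A': "rvec n A \<in> space M \<rightarrow> space (\<Pi>\<^sub>M i\<in>{1..n}. borel)"
    and B': "rvec n B \<in> space M \<rightarrow> space (\<Pi>\<^sub>M i\<in>{1..n}. borel)"
    using measurable_space[OF A] measurable_space[OF B] by blast+
  have "indep_set (sets (vimage_algebra (space M) (rvec n A) (\<Pi>\<^sub>M i\<in>{1..n}. borel)))
        (sets (vimage_algebra (space M) (rvec n B) (\<Pi>\<^sub>M i\<in>{1..n}. borel)))"
    using rp unfolding random_params_def by simp
  then have "indep_set (sigma_sets (space M) {(\<lambda>\<omega>. \<phi> (rvec n A \<omega>)) -` C \<inter> space M |C. C \<in> sets S})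
        (sigma_sets (space M) {(\<lambda>\<omega>. \<psi> (rvec n B \<omega>)) -` C \<inter> space M |C. C \<in> sets T})"
    unfolding indep_set_def
    using sets_vimage_algebra_compose[OF A' \<phi>]
      sets_vimage_algebra_compose[OF B' \<psi>]
    by (elim indep_sets_mono_sets) (simp split: bool.split)
  then show ?thesis
    unfolding indep_var_eq using measurable_compose[OF A \<phi>] measurable_compose[OF B \<psi>] by simp
qed

lemma
  fixes u :: "real ^ 'd \<Rightarrow> real" and k :: "real \<Rightarrow> real"
  assumes rp: "random_params M n p A B" and i: "i \<in> {1..n}"
    and [measurable]: "u \<in> borel_measurable borel" "k \<in> borel_measurable borel"
    and int: "integrable M (\<lambda>\<omega>. u (A i \<omega>))" "integrable M (\<lambda>\<omega>. k (B i \<omega>))"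
  shows integrable_random_params_single: "integrable M (\<lambda>\<omega>. k (B i \<omega>) * u (A i \<omega>))"
    and expectation_random_params_single: "expectation (\<lambda>\<omega>. k (B i \<omega>) * u (A i \<omega>)) =
      expectation (\<lambda>\<omega>. k (B i \<omega>)) * expectation (\<lambda>\<omega>. u (A i \<omega>))"
proof -
  have "indep_var borel (\<lambda>\<omega>. (\<lambda>a. u (a i)) (rvec n A \<omega>)) borel (\<lambda>\<omega>. (\<lambda>b. k (b i)) (rvec n B \<omega>))"
    using i by (intro indep_var_random_params[OF rp]) measurable
  then have "indep_var borel (\<lambda>\<omega>. u (A i \<omega>)) borel (\<lambda>\<omega>. k (B i \<omega>))"
    using i by (simp add: rvec_def)
  from indep_var_integrable[OF this int] indep_var_lebesgue_integral[OF this int]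
  show "integrable M (\<lambda>\<omega>. k (B i \<omega>) * u (A i \<omega>))"
    and "expectation (\<lambda>\<omega>. k (B i \<omega>) * u (A i \<omega>)) =
      expectation (\<lambda>\<omega>. k (B i \<omega>)) * expectation (\<lambda>\<omega>. u (A i \<omega>))"
    by (simp_all add: mult.commute)
qed

lemma
  fixes X :: "nat \<Rightarrow> 'a \<Rightarrow> 'b :: topological_space" and u u' :: "'b \<Rightarrow> real"
  assumes ind: "indep_vars (\<lambda>_. borel) X I" and ij: "i \<in> I" "j \<in> I" "i \<noteq> j"
    and u: "u \<in> borel_measurable borel" "u' \<in> borel_measurable borel"
    and int: "integrable M (\<lambda>\<omega>. u (X i \<omega>))" "integrable M (\<lambda>\<omega>. u' (X j \<omega>))"
  shows integrable_indep_vars_pair: "integrable M (\<lambda>\<omega>. u (X i \<omega>) * u' (X j \<omega>))"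
    and expectation_indep_vars_pair: "expectation (\<lambda>\<omega>. u (X i \<omega>) * u' (X j \<omega>)) =
      expectation (\<lambda>\<omega>. u (X i \<omega>)) * expectation (\<lambda>\<omega>. u' (X j \<omega>))"
proof -
  have "indep_var borel (X i) borel (X j)"
    \<comment> \<open>The restrictions of the family to the disjoint sets \<open>{i}\<close> and
      \<open>{j}\<close> are independent; evaluation at the single index recovers the
      variables.\<close>
    using indep_var_compose[OF indep_var_restrict[OF ind, of "{i}" "{j}"],
        of "\<lambda>f. f i" borel "\<lambda>f. f j" borel] ij
    by (simp add: comp_def)
  from indep_var_compose[OF this u, unfolded comp_def]
  show "integrable M (\<lambda>\<omega>. u (X i \<omega>) * u' (X j \<omega>))"
    and "expectation (\<lambda>\<omega>. u (X i \<omega>) * u' (X j \<omega>)) =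
      expectation (\<lambda>\<omega>. u (X i \<omega>)) * expectation (\<lambda>\<omega>. u' (X j \<omega>))"
    using int by (auto intro: indep_var_integrable indep_var_lebesgue_integral)
qed

text \<open>The expectation is factored twice: first the part in \<open>A\<close> from the part in
  \<open>B\<close>, then within each of them index \<open>i\<close> from index
  \<open>j\<close>.\<close>

lemma
  fixes u u' :: "real ^ 'd \<Rightarrow> real" and k k' :: "real \<Rightarrow> real"
  assumes rp: "random_params M n p A B" and ij: "i \<in> {1..n}" "j \<in> {1..n}" "i \<noteq> j"
    and [measurable]: "u \<in> borel_measurable borel" "k \<in> borel_measurable borel"
      "u' \<in> borel_measurable borel" "k' \<in> borel_measurable borel"
    and int: "integrable M (\<lambda>\<omega>. u (A i \<omega>))" "integrable M (\<lambda>\<omega>. u' (A j \<omega>))"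
      "integrable M (\<lambda>\<omega>. k (B i \<omega>))" "integrable M (\<lambda>\<omega>. k' (B j \<omega>))"
  shows integrable_random_params_pair:
      "integrable M (\<lambda>\<omega>. (k (B i \<omega>) * u (A i \<omega>)) * (k' (B j \<omega>) * u' (A j \<omega>)))"
    and expectation_random_params_pair:
      "expectation (\<lambda>\<omega>. (k (B i \<omega>) * u (A i \<omega>)) * (k' (B j \<omega>) * u' (A j \<omega>))) =
        (expectation (\<lambda>\<omega>. k (B i \<omega>)) * expectation (\<lambda>\<omega>. u (A i \<omega>))) *
        (expectation (\<lambda>\<omega>. k' (B j \<omega>)) * expectation (\<lambda>\<omega>. u' (A j \<omega>)))"
proof -
  have "indep_var borel (\<lambda>\<omega>. (\<lambda>a. u (a i) * u' (a j)) (rvec n A \<omega>)) borel (\<lambda>\<omega>. (\<lambda>b. k (b i) * k' (b j)) (rvec n B \<omega>))"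
    using ij by (intro indep_var_random_params[OF rp]) measurable
  then have ind: "indep_var borel (\<lambda>\<omega>. u (A i \<omega>) * u' (A j \<omega>)) borel (\<lambda>\<omega>. k (B i \<omega>) * k' (B j \<omega>))"
    using ij by (simp add: rvec_def)
  have "indep_vars (\<lambda>_. borel) A {1..n}" "indep_vars (\<lambda>_. borel) B {1..n}"
    using rp unfolding random_params_def by auto
  note A = this(1) and B = this(2)
  note iA = integrable_indep_vars_pair[OF A ij, of u u'] and iB = integrable_indep_vars_pair[OF B ij, of k k']
  note eA = expectation_indep_vars_pair[OF A ij, of u u'] and eB = expectation_indep_vars_pair[OF B ij, of k k']
  have eq: "(k (B i \<omega>) * u (A i \<omega>)) * (k' (B j \<omega>) * u' (A j \<omega>)) = (u (A i \<omega>) * u' (A j \<omega>)) * (k (B i \<omega>) * k' (B j \<omega>))" for \<omega>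
    by (simp add: mult_ac)
  show "integrable M (\<lambda>\<omega>. (k (B i \<omega>) * u (A i \<omega>)) * (k' (B j \<omega>) * u' (A j \<omega>)))"
    unfolding eq using iA iB int by (intro indep_var_integrable[OF ind]) auto
  have "expectation (\<lambda>\<omega>. (k (B i \<omega>) * u (A i \<omega>)) * (k' (B j \<omega>) * u' (A j \<omega>))) =
    expectation (\<lambda>\<omega>. u (A i \<omega>) * u' (A j \<omega>)) * expectation (\<lambda>\<omega>. k (B i \<omega>) * k' (B j \<omega>))"
    unfolding eq using iA iB int by (intro indep_var_lebesgue_integral[OF ind]) auto
  then show "expectation (\<lambda>\<omega>. (k (B i \<omega>) * u (A i \<omega>)) * (k' (B j \<omega>) * u' (A j \<omega>))) =
        (expectation (\<lambda>\<omega>. k (B i \<omega>)) * expectation (\<lambda>\<omega>. u (A i \<omega>))) *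
        (expectation (\<lambda>\<omega>. k' (B j \<omega>)) * expectation (\<lambda>\<omega>. u' (A j \<omega>)))"
    using eA eB int by (simp add: mult_ac)
qed

text \<open>\<open>Z i\<close> is the feature \<open>u b\<close> at \<open>A i\<close> with
  \<open>b\<close> selected by the fair bit \<open>B i\<close>, so its moments are the averages over
  both bits of integrals against the density. Independence over \<open>i\<close> makes distinct
  features uncorrelated.\<close>

lemma random_params_sample_mean:
  fixes u :: "real \<Rightarrow> real ^ 'd \<Rightarrow> real"
  assumes rp: "random_params M n p A B" and n: "n \<ge> 1" and p0: "\<And>\<xi>. 0 \<le> p \<xi>"
    and u: "\<And>b. u b \<in> borel_measurable borel"
    and usq: "\<And>b. integrable lborel (\<lambda>\<xi>. p \<xi> * (u b \<xi>)\<^sup>2)"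
  defines "Z \<equiv> \<lambda>i \<omega>. \<Sum>b\<in>{0, 1}. indicator {b} (B i \<omega>) * u b (A i \<omega>)"
    and "m \<equiv> (\<Sum>b\<in>{0, 1}. \<integral>\<xi>. p \<xi> * u b \<xi> \<partial>lborel) / 2"
    and "s \<equiv> (\<Sum>b\<in>{0, 1}. \<integral>\<xi>. p \<xi> * (u b \<xi>)\<^sup>2 \<partial>lborel) / 2"
  shows "integrable M (\<lambda>\<omega>. ((\<Sum>i=1..n. Z i \<omega>) / n - m)\<^sup>2)"
    and "expectation (\<lambda>\<omega>. ((\<Sum>i=1..n. Z i \<omega>) / n - m)\<^sup>2) = (s - m\<^sup>2) / n"
proof -
  note [measurable] = u random_params_measurable[OF rp]
  have dA: "distributed M lborel (A i) (\<lambda>\<xi>. ennreal (p \<xi>))" if "i \<in> {1..n}" for i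
    using rp that unfolding random_params_def by auto
  have iA2: "integrable M (\<lambda>\<omega>. (u b (A i \<omega>))\<^sup>2)" if "i \<in> {1..n}" for i b
    using distributed_integrable[OF dA[OF that], of "\<lambda>\<xi>. (u b \<xi>)\<^sup>2"] usq p0 by simp
  have iA: "integrable M (\<lambda>\<omega>. u b (A i \<omega>))" if "i \<in> {1..n}" for i b
    using that by (intro square_integrable_imp_integrable[OF _ iA2]) measurable
  have eA: "expectation (\<lambda>\<omega>. u b (A i \<omega>)) = (\<integral>\<xi>. p \<xi> * u b \<xi> \<partial>lborel)" if "i \<in> {1..n}" for i b
    using distributed_integral[OF dA[OF that], of "u b"] p0 by simp
  have iB: "integrable M (\<lambda>\<omega>. indicator {b} (B i \<omega>) :: real)" if "i \<in> {1..n}" for i b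
    using that by (intro integrable_const_bound[of _ 1]) (auto simp: indicator_def)
  have eB: "expectation (\<lambda>\<omega>. indicator {b} (B i \<omega>)) = (1 / 2 :: real)" if i: "i \<in> {1..n}" and b: "b \<in> {0, 1}" for i b
  proof -
    have "expectation (\<lambda>\<omega>. indicator {b} (B i \<omega>) :: real) = expectation (indicator {\<omega> \<in> space M. B i \<omega> = b})"
      by (intro Bochner_Integration.integral_cong) (auto simp: indicator_def)
    also have "\<dots> = prob {\<omega> \<in> space M. B i \<omega> = b}"
      by (simp add: Int_absorb2 Collect_mono_iff)
    finally show ?thesis using rp i b unfolding random_params_def by auto
  qed
  have Z [measurable]: "Z i \<in> borel_measurable M" if "i \<in> {1..n}" for i
    unfolding Z_def using that by measurable
  \<comment> \<open>At most one of the two indicators is nonzero, so squaring produces no cross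
    terms.\<close>
  have Z2: "(Z i \<omega>)\<^sup>2 = (\<Sum>b\<in>{0, 1}. indicator {b} (B i \<omega>) * (u b (A i \<omega>))\<^sup>2)" for i \<omega>
    unfolding Z_def sum_zero_one by (auto simp: indicator_def)
  \<comment> \<open>Stated for a general \<open>v\<close>, since the mean uses
    \<open>v = u b\<close> and the second moment uses its square.\<close>
  have single: "integrable M (\<lambda>\<omega>. indicator {b} (B i \<omega>) * v (A i \<omega>))"
      "expectation (\<lambda>\<omega>. indicator {b} (B i \<omega>) * v (A i \<omega>)) = (\<integral>\<xi>. p \<xi> * v \<xi> \<partial>lborel) / 2"
    if i: "i \<in> {1..n}" and b: "b \<in> {0, 1}" and v: "v \<in> borel_measurable borel" "integrable M (\<lambda>\<omega>. v (A i \<omega>))"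
    for i b and v :: "real ^ 'd \<Rightarrow> real"
  proof -
    have k: "indicator {b} \<in> borel_measurable (borel :: real measure)" by measurable
    show "integrable M (\<lambda>\<omega>. indicator {b} (B i \<omega>) * v (A i \<omega>))"
      by (rule integrable_random_params_single[OF rp i v(1) k v(2) iB[OF i]])
    have "(\<integral>\<xi>. p \<xi> * v \<xi> \<partial>lborel) = expectation (\<lambda>\<omega>. v (A i \<omega>))"
      using distributed_integral[OF dA[OF i], of v] p0 v by simp
    with expectation_random_params_single[OF rp i v(1) k v(2) iB[OF i]] eB[OF i b]
    show "expectation (\<lambda>\<omega>. indicator {b} (B i \<omega>) * v (A i \<omega>)) = (\<integral>\<xi>. p \<xi> * v \<xi> \<partial>lborel) / 2"
      by simp
  qed
  have u2: "(\<lambda>\<xi>. (u b \<xi>)\<^sup>2) \<in> borel_measurable borel" for b by measurable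
  note single2 = single[OF _ _ u2 iA2] and single1 = single[OF _ _ u iA]
  have sq: "integrable M (\<lambda>\<omega>. (Z i \<omega>)\<^sup>2)" if "i \<in> {1..n}" for i
    unfolding Z2 by (intro Bochner_Integration.integrable_sum single2 that)
  have second: "expectation (\<lambda>\<omega>. (Z i \<omega>)\<^sup>2) = s" if "i \<in> {1..n}" for i
    unfolding Z2 s_def sum_divide_distrib
    by (subst Bochner_Integration.integral_sum, intro single2 that, assumption)
      (intro sum.cong refl single2 that, assumption)
  have mean: "expectation (Z i) = m" if "i \<in> {1..n}" for i
    unfolding Z_def m_def sum_divide_distrib
    by (subst Bochner_Integration.integral_sum, intro single1 that, assumption)
      (intro sum.cong refl single1 that, assumption)
  have uncorr: "expectation (\<lambda>\<omega>. Z i \<omega> * Z j \<omega>) = m * m" if ij: "i \<in> {1..n}" "j \<in> {1..n}" "i \<noteq> j" for i j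
  proof -
    let ?t = "\<lambda>b c \<omega>. (indicator {b} (B i \<omega>) * u b (A i \<omega>)) * (indicator {c} (B j \<omega>) * u c (A j \<omega>))"
    have it: "integrable M (?t b c)" for b c
      using ij by (intro integrable_random_params_pair[OF rp ij] iA iB u) auto
    have et: "expectation (?t b c) = (1 / 2 * (\<integral>\<xi>. p \<xi> * u b \<xi> \<partial>lborel)) * (1 / 2 * (\<integral>\<xi>. p \<xi> * u c \<xi> \<partial>lborel))"
      if "b \<in> {0, 1}" "c \<in> {0, 1}" for b c
      using ij that by (subst expectation_random_params_pair[OF rp ij]) (auto simp: iA iB eA eB u)
    have "expectation (\<lambda>\<omega>. Z i \<omega> * Z j \<omega>) = expectation (\<lambda>\<omega>. \<Sum>b\<in>{0, 1}. \<Sum>c\<in>{0, 1}. ?t b c \<omega>)"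
      unfolding Z_def sum_product ..
    also have "\<dots> = (\<Sum>b\<in>{0, 1}. \<Sum>c\<in>{0, 1}. expectation (?t b c))"
      using it by (simp only: Bochner_Integration.integral_sum Bochner_Integration.integrable_sum)
    also have "\<dots> = (\<Sum>b\<in>{0, 1}. \<Sum>c\<in>{0, 1}. (1 / 2 * (\<integral>\<xi>. p \<xi> * u b \<xi> \<partial>lborel)) * (1 / 2 * (\<integral>\<xi>. p \<xi> * u c \<xi> \<partial>lborel)))"
      by (intro sum.cong refl et)
    also have "\<dots> = m * m"
      unfolding m_def sum_zero_one by (simp add: field_simps)
    finally show ?thesis .
  qed
  show "integrable M (\<lambda>\<omega>. ((\<Sum>i=1..n. Z i \<omega>) / n - m)\<^sup>2)"
    using n integrable_sample_mean_error[of "{1..n}", OF _ _ Z sq mean second uncorr] by auto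
  show "expectation (\<lambda>\<omega>. ((\<Sum>i=1..n. Z i \<omega>) / n - m)\<^sup>2) = (s - m\<^sup>2) / n"
    using n expectation_sample_mean_error[of "{1..n}", OF _ _ Z sq mean second uncorr] by auto
qed

end

section \<open>The approximation bound\<close>

lemma fourier_inversion_real:
  fixes f :: "real ^ 'd \<Rightarrow> real"
  assumes f: "integrable lborel f" and F: "integrable lborel (fourier f)" and cont: "continuous_on UNIV f"
  shows "(\<integral>\<xi>. Re (fourier f \<xi> * cis (2 * pi * inner x \<xi>)) \<partial>lborel) = f x"
proof -
  have eq: "fourier f = (\<lambda>\<xi>. \<integral>y. cis (- 2 * pi * inner y \<xi>) * complex_of_real (f y) \<partial>lborel)"
    unfolding fourier_def cis_conv_exp by (simp add: mult_ac)
  have c: "isCont (\<lambda>y. complex_of_real (f y)) x"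
    using cont by (intro isCont_of_real) (simp add: continuous_on_eq_continuous_at)
  have "(\<integral>\<xi>. fourier f \<xi> * cis (2 * pi * inner x \<xi>) \<partial>lborel) = complex_of_real (f x)"
    unfolding eq by (rule fourier_inversion[OF integrable_of_real[OF f] F[unfolded eq] c])
  moreover have "integrable lborel (\<lambda>\<xi>. fourier f \<xi> * cis (2 * pi * inner x \<xi>))"
    by (rule Bochner_Integration.integrable_bound[OF F]) (use F in \<open>auto simp: norm_mult\<close>)
  ultimately show ?thesis
    by (simp only: integral_Re Re_complex_of_real)
qed

text \<open>The \<open>ennreal\<close> quotient is infinite where the density vanishes and the
  transform does not, so finite energy makes this set null. Elsewhere the real and the
  \<open>ennreal\<close> quotient agree.\<close>

lemma
  fixes p f :: "real ^ 'd \<Rightarrow> real"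
  assumes p [measurable]: "p \<in> borel_measurable borel" and p0: "\<And>\<xi>. 0 \<le> p \<xi>"
    and [measurable]: "fourier f \<in> borel_measurable borel" and fin: "weighted_energy p f < \<infinity>"
  shows weighted_energy_AE: "AE \<xi> in lborel. p \<xi> = 0 \<longrightarrow> fourier f \<xi> = 0"
    and weighted_energy_integrable: "integrable lborel (\<lambda>\<xi>. (cmod (fourier f \<xi>))\<^sup>2 / p \<xi>)"
    and weighted_energy_integral_le: "(\<integral>\<xi>. (cmod (fourier f \<xi>))\<^sup>2 / p \<xi> \<partial>lborel) \<le> enn2real (weighted_energy p f)"
proof -
  have "AE \<xi> in lborel. ennreal ((cmod (fourier f \<xi>))\<^sup>2) / ennreal (p \<xi>) \<noteq> \<infinity>"
    using fin unfolding weighted_energy_def by (intro nn_integral_noteq_infinite) auto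
  then show "AE \<xi> in lborel. p \<xi> = 0 \<longrightarrow> fourier f \<xi> = 0"
    by eventually_elim (auto simp: ennreal_divide_eq_top_iff)
  \<comment> \<open>For \<open>p \<xi> = 0\<close> the real quotient is \<open>0\<close> by
    convention, hence never too large.\<close>
  have "ennreal ((cmod (fourier f \<xi>))\<^sup>2 / p \<xi>) \<le> ennreal ((cmod (fourier f \<xi>))\<^sup>2) / ennreal (p \<xi>)" for \<xi>
    using p0[of \<xi>] by (cases "p \<xi> = 0") (auto simp: divide_ennreal)
  then have le: "(\<integral>\<^sup>+\<xi>. ennreal ((cmod (fourier f \<xi>))\<^sup>2 / p \<xi>) \<partial>lborel) \<le> weighted_energy p f"
    unfolding weighted_energy_def by (intro nn_integral_mono)
  have nn: "0 \<le> (cmod (fourier f \<xi>))\<^sup>2 / p \<xi>" for \<xi>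
    using p0 by simp
  show "integrable lborel (\<lambda>\<xi>. (cmod (fourier f \<xi>))\<^sup>2 / p \<xi>)"
    using le fin nn by (intro integrableI_nonneg) auto
  have "(\<integral>\<xi>. (cmod (fourier f \<xi>))\<^sup>2 / p \<xi> \<partial>lborel) = enn2real (\<integral>\<^sup>+\<xi>. ennreal ((cmod (fourier f \<xi>))\<^sup>2 / p \<xi>) \<partial>lborel)"
    using nn by (intro integral_eq_nn_integral) auto
  also have "\<dots> \<le> enn2real (weighted_energy p f)"
    using le fin by (intro enn2real_mono) auto
  finally show "(\<integral>\<xi>. (cmod (fourier f \<xi>))\<^sup>2 / p \<xi> \<partial>lborel) \<le> enn2real (weighted_energy p f)" .
qed

text \<open>Where \<open>p\<close> vanishes the quotient is the junk value \<open>0\<close>; finiteness of the weighted energy makes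
  the Fourier transform vanish there almost everywhere, so nothing is lost.\<close>

definition importance_weight :: "(real ^ 'd \<Rightarrow> real) \<Rightarrow> (real ^ 'd \<Rightarrow> real) \<Rightarrow> real \<Rightarrow> real ^ 'd \<Rightarrow> real" where
  "importance_weight p f b \<xi> = 2 * (if b = 0 then Re (fourier f \<xi>) else Im (fourier f \<xi>)) / p \<xi>"

lemma importance_weight_measurable [measurable (raw)]:
  assumes [measurable]: "p \<in> borel_measurable borel" "fourier f \<in> borel_measurable borel"
  shows "importance_weight p f b \<in> borel_measurable borel"
  unfolding importance_weight_def by measurable

theorem mainTheorem2:
  fixes \<mu> :: "(real ^ 'd::{finite,linorder}) measure"
    and \<pi>\<^sub>a f :: "real ^ 'd::{finite,linorder} \<Rightarrow> real"
    and n :: nat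
    and M :: "'w measure"
    and A :: "nat \<Rightarrow> 'w \<Rightarrow> real ^ 'd::{finite,linorder}"
    and B :: "nat \<Rightarrow> 'w \<Rightarrow> real"
    and V :: "complex mat"
  assumes "prob_space \<mu>" and "sets \<mu> = sets borel"
    and "\<pi>\<^sub>a \<in> borel_measurable borel" and "\<And>\<xi>. 0 \<le> \<pi>\<^sub>a \<xi>"
    and "(\<integral>\<^sup>+ \<xi>. ennreal (\<pi>\<^sub>a \<xi>) \<partial>lborel) = 1"
    and "n \<ge> 1"
    and "prob_space M" and "random_params M n \<pi>\<^sub>a A B"
    and "state_prep n V"
    and "f \<in> Fbar \<pi>\<^sub>a"
  shows "\<exists>W \<in> measurable (sigma_AB M n A B) (\<Pi>\<^sub>M j\<in>{0..<n}. borel).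
           let E = (\<integral>\<^sup>+ \<omega>. (\<integral>\<^sup>+ x.
                     ennreal (\<bar>qrnn n V (\<lambda>i. A i \<omega>) (\<lambda>i. B i \<omega>) (W \<omega>) x - f x\<bar>\<^sup>2) \<partial>\<mu>) \<partial>M)
           in E < \<infinity> \<and> sqrt (enn2real E) \<le> L2bar \<pi>\<^sub>a f / sqrt (real n)"
proof -
  interpret M: prob_space M by fact
  interpret \<mu>: prob_space \<mu> by fact
  interpret pair_sigma_finite \<mu> M ..
  note p0 = assms(4) and n = assms(6) and rp = assms(8)
  have f: "continuous_on UNIV f" "integrable lborel f" "integrable lborel (fourier f)" "weighted_energy \<pi>\<^sub>a f < \<infinity>"
    using assms(10) unfolding Fbar_def by auto
  have [measurable]: "\<pi>\<^sub>a \<in> borel_measurable borel" "f \<in> borel_measurable borel" "fourier f \<in> borel_measurable borel"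
    using assms(3) f by auto
  note [measurable] = M.random_params_measurable[OF rp]
  note [measurable_cong] = assms(2)
  let ?E = "enn2real (weighted_energy \<pi>\<^sub>a f)"
  define h where "h = importance_weight \<pi>\<^sub>a f"
  have h [measurable]: "h b \<in> borel_measurable borel" for b
    unfolding h_def by measurable
  define u where "u = (\<lambda>x b \<xi>. h b \<xi> * cos (2 * pi * inner \<xi> x + pi / 2 * b))"
  have u [measurable]: "u x b \<in> borel_measurable borel" for x b
    unfolding u_def by measurable
  \<comment> \<open>With indicators, values of \<open>B\<close> outside \<open>{0, 1}\<close> get
    weight \<open>0\<close>, and the weighted cosine is exactly the feature \<open>Z\<close> of
    \<open>random_params_sample_mean\<close>.\<close>
  define g where "g = (\<lambda>a b'. \<Sum>b\<in>{0, 1}. indicator {b} b' * h b a)"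
  define W where "W = (\<lambda>\<omega>. \<lambda>j\<in>{0..<n}. g (A (Suc j) \<omega>) (B (Suc j) \<omega>))"
  define Z where "Z = (\<lambda>x i \<omega>. \<Sum>b\<in>{0, 1}. indicator {b} (B i \<omega>) * u x b (A i \<omega>))"
  have W: "W \<in> measurable (sigma_AB M n A B) (\<Pi>\<^sub>M j\<in>{0..<n}. borel)"
  proof -
    \<comment> \<open>\<open>W\<close> factors through the pair of parameter vectors, which is what
      measurability with respect to \<open>sigma_AB\<close> asks for. Its index starts at
      \<open>0\<close>, that of the parameters at \<open>1\<close>.\<close>
    define \<Phi> where "\<Phi> = (\<lambda>(a, b). \<lambda>j\<in>{0..<n}. g (a (Suc j)) (b (Suc j)))"
    have "\<Phi> \<in> measurable ((\<Pi>\<^sub>M i\<in>{1..n}. borel) \<Otimes>\<^sub>M (\<Pi>\<^sub>M i\<in>{1..n}. borel)) (\<Pi>\<^sub>M j\<in>{0..<n}. borel)"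
      unfolding \<Phi>_def g_def by measurable
    moreover have "(\<lambda>\<omega>. (rvec n A \<omega>, rvec n B \<omega>)) \<in> measurable (sigma_AB M n A B) ((\<Pi>\<^sub>M i\<in>{1..n}. borel) \<Otimes>\<^sub>M (\<Pi>\<^sub>M i\<in>{1..n}. borel))"
      unfolding sigma_AB_def
      by (intro measurable_vimage_algebra1) (auto simp: space_pair_measure space_PiM rvec_def)
    ultimately have "(\<lambda>\<omega>. \<Phi> (rvec n A \<omega>, rvec n B \<omega>)) \<in> measurable (sigma_AB M n A B) (\<Pi>\<^sub>M j\<in>{0..<n}. borel)"
      by (rule measurable_compose[rotated])
    also have "(\<lambda>\<omega>. \<Phi> (rvec n A \<omega>, rvec n B \<omega>)) = W"
      by (auto simp: \<Phi>_def W_def rvec_def fun_eq_iff)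
    finally show ?thesis .
  qed
  have F_eq: "qrnn n V (\<lambda>i. A i \<omega>) (\<lambda>i. B i \<omega>) (W \<omega>) x = (\<Sum>i=1..n. Z x i \<omega>) / n" for x \<omega>
  proof -
    have "W \<omega> j * cos (2 * pi * inner (A (Suc j) \<omega>) x + pi / 2 * B (Suc j) \<omega>) = Z x (Suc j) \<omega>" if "j < n" for j
      using that unfolding W_def g_def Z_def u_def sum_zero_one by (auto simp: indicator_def)
    then show ?thesis
      unfolding qrnn_eq[OF assms(9)] One_nat_def sum.atLeast1_atMost_eq atLeast0LessThan by simp
  qed
  \<comment> \<open>Squared real and imaginary parts add up to the squared modulus. Where
    \<open>\<pi>\<^sub>a\<close> vanishes both sides are \<open>0\<close>. The factor
    \<open>4\<close>, halved by the fair bit, becomes the \<open>2\<close> in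
    \<open>L2bar\<close>.\<close>
  have energy: "\<pi>\<^sub>a \<xi> * (h 0 \<xi>)\<^sup>2 + \<pi>\<^sub>a \<xi> * (h 1 \<xi>)\<^sup>2 = 4 * ((cmod (fourier f \<xi>))\<^sup>2 / \<pi>\<^sub>a \<xi>)" for \<xi>
    unfolding cmod_power2 by (simp add: h_def importance_weight_def power2_eq_square field_simps)
  have energy_int: "integrable lborel (\<lambda>\<xi>. 4 * ((cmod (fourier f \<xi>))\<^sup>2 / \<pi>\<^sub>a \<xi>))"
    by (intro integrable_mult_right weighted_energy_integrable[OF assms(3) p0 _ f(4)]) measurable
  note energy_le = weighted_energy_integral_le[OF assms(3) p0 _ f(4)]
    and energy_AE = weighted_energy_AE[OF assms(3) p0 _ f(4)]
  have u_le: "\<pi>\<^sub>a \<xi> * (u x b \<xi>)\<^sup>2 \<le> \<pi>\<^sub>a \<xi> * (h b \<xi>)\<^sup>2" for x b \<xi>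
    using p0 by (intro mult_left_mono) (auto simp: u_def power_mult_distrib mult_left_le abs_square_le_1)
  have h_le: "\<pi>\<^sub>a \<xi> * (h b \<xi>)\<^sup>2 \<le> 4 * ((cmod (fourier f \<xi>))\<^sup>2 / \<pi>\<^sub>a \<xi>)" for b \<xi>
  proof -
    \<comment> \<open>Every nonzero \<open>b\<close> yields the weight for \<open>1\<close>, so the
      bound holds for all real \<open>b\<close>, as \<open>random_params_sample_mean\<close>
      requires.\<close>
    have "h b = h 0 \<or> h b = h 1" by (auto simp: h_def importance_weight_def fun_eq_iff)
    moreover have "0 \<le> \<pi>\<^sub>a \<xi> * (h c \<xi>)\<^sup>2" for c using p0 by simp
    ultimately show ?thesis using energy[of \<xi>] by (metis le_add_same_cancel1 le_add_same_cancel2)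
  qed
  have usq: "integrable lborel (\<lambda>\<xi>. \<pi>\<^sub>a \<xi> * (u x b \<xi>)\<^sup>2)" for x b
  proof (rule Bochner_Integration.integrable_bound)
    show "integrable lborel (\<lambda>\<xi>. 4 * ((cmod (fourier f \<xi>))\<^sup>2 / \<pi>\<^sub>a \<xi>))"
      by (fact energy_int)
    show "AE \<xi> in lborel. norm (\<pi>\<^sub>a \<xi> * (u x b \<xi>)\<^sup>2) \<le> norm (4 * ((cmod (fourier f \<xi>))\<^sup>2 / \<pi>\<^sub>a \<xi>))"
    proof (rule AE_I2)
      fix \<xi>
      have "0 \<le> \<pi>\<^sub>a \<xi> * (u x b \<xi>)\<^sup>2" using p0 by simp
      with order_trans[OF u_le h_le] show "norm (\<pi>\<^sub>a \<xi> * (u x b \<xi>)\<^sup>2) \<le> norm (4 * ((cmod (fourier f \<xi>))\<^sup>2 / \<pi>\<^sub>a \<xi>))"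
        by (smt (verit) real_norm_def)
    qed
  qed measurable
  have ulin: "integrable lborel (\<lambda>\<xi>. \<pi>\<^sub>a \<xi> * u x b \<xi>)" for x b
  proof (rule Bochner_Integration.integrable_bound)
    show "integrable lborel (\<lambda>\<xi>. 2 * norm (fourier f \<xi>))"
      using f(3) by auto
    have "\<bar>\<pi>\<^sub>a \<xi> * h b \<xi>\<bar> \<le> 2 * norm (fourier f \<xi>)" for \<xi>
      using abs_Re_le_cmod[of "fourier f \<xi>"] abs_Im_le_cmod[of "fourier f \<xi>"]
      by (auto simp: h_def importance_weight_def abs_mult)
    moreover have "\<bar>\<pi>\<^sub>a \<xi> * u x b \<xi>\<bar> \<le> \<bar>\<pi>\<^sub>a \<xi> * h b \<xi>\<bar>" for \<xi>
      unfolding u_def abs_mult mult.assoc[symmetric] by (intro mult_left_le) auto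
    ultimately show "AE \<xi> in lborel. norm (\<pi>\<^sub>a \<xi> * u x b \<xi>) \<le> norm (2 * norm (fourier f \<xi>))"
      by (intro AE_I2) (smt (verit) real_norm_def)
  qed measurable
  have mean: "(\<Sum>b\<in>{0, 1}. \<integral>\<xi>. \<pi>\<^sub>a \<xi> * u x b \<xi> \<partial>lborel) / 2 = f x" for x
  proof -
    have "(\<Sum>b\<in>{0, 1}. \<integral>\<xi>. \<pi>\<^sub>a \<xi> * u x b \<xi> \<partial>lborel) / 2 = (\<integral>\<xi>. (\<pi>\<^sub>a \<xi> * u x 0 \<xi> + \<pi>\<^sub>a \<xi> * u x 1 \<xi>) / 2 \<partial>lborel)"
      using ulin by simp
    also have "\<dots> = (\<integral>\<xi>. Re (fourier f \<xi> * cis (2 * pi * inner x \<xi>)) \<partial>lborel)"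
    proof (rule integral_cong_AE)
      show "AE \<xi> in lborel. (\<pi>\<^sub>a \<xi> * u x 0 \<xi> + \<pi>\<^sub>a \<xi> * u x 1 \<xi>) / 2 = Re (fourier f \<xi> * cis (2 * pi * inner x \<xi>))"
        using energy_AE[OF \<open>fourier f \<in> borel_measurable borel\<close>]
      proof eventually_elim
        case (elim \<xi>)
        \<comment> \<open>The quarter period turns the cosine into minus the sine, so the two
          features combine to \<open>Re * cos - Im * sin\<close>, the real part of the inversion
          integrand. The factor \<open>2\<close> in the weight cancels the probability of each bit;
          zeros of \<open>\<pi>\<^sub>a\<close> are covered by \<open>energy_AE\<close>.\<close>
        have "cos (2 * pi * inner \<xi> x + pi / 2) = - sin (2 * pi * inner \<xi> x)"
          by (simp add: cos_add)
        then show ?case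
          using elim by (cases "\<pi>\<^sub>a \<xi> = 0")
            (simp_all add: u_def h_def importance_weight_def inner_commute algebra_simps diff_divide_distrib)
      qed
    qed measurable
    also have "\<dots> = f x" by (rule fourier_inversion_real[OF f(2,3,1)])
    finally show ?thesis .
  qed
  have second: "(\<Sum>b\<in>{0, 1}. \<integral>\<xi>. \<pi>\<^sub>a \<xi> * (u x b \<xi>)\<^sup>2 \<partial>lborel) / 2 \<le> 2 * ?E" for x
  proof -
    have "(\<Sum>b\<in>{0, 1}. \<integral>\<xi>. \<pi>\<^sub>a \<xi> * (u x b \<xi>)\<^sup>2 \<partial>lborel) = (\<integral>\<xi>. \<pi>\<^sub>a \<xi> * (u x 0 \<xi>)\<^sup>2 + \<pi>\<^sub>a \<xi> * (u x 1 \<xi>)\<^sup>2 \<partial>lborel)"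
      using usq by simp
    also have "\<dots> \<le> (\<integral>\<xi>. 4 * ((cmod (fourier f \<xi>))\<^sup>2 / \<pi>\<^sub>a \<xi>) \<partial>lborel)"
      by (intro integral_mono energy_int Bochner_Integration.integrable_add usq,
          unfold energy[symmetric], intro add_mono u_le)
    also have "\<dots> \<le> 4 * ?E" unfolding integral_mult_right_zero using energy_le by simp
    finally show ?thesis by simp
  qed
  have pointwise: "(\<integral>\<^sup>+\<omega>. ennreal (((\<Sum>i=1..n. Z x i \<omega>) / n - f x)\<^sup>2) \<partial>M) \<le> ennreal (2 * ?E / n)" for x
  proof -
    let ?S = "\<lambda>\<omega>. ((\<Sum>i=1..n. Z x i \<omega>) / n - f x)\<^sup>2"
    note S = M.random_params_sample_mean[where u = "u x", OF rp n p0 u usq, unfolded mean]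
    have "(\<integral>\<^sup>+\<omega>. ennreal (?S \<omega>) \<partial>M) = ennreal (M.expectation ?S)"
      unfolding Z_def by (intro nn_integral_eq_integral S(1)) auto
    also have "\<dots> \<le> ennreal (2 * ?E / n)"
      \<comment> \<open>The variance is at most the second moment, since the square of the mean
        \<open>f x\<close> is only subtracted.\<close>
      unfolding Z_def S(2) using second[of x] zero_le_power2[of "f x"]
      by (intro ennreal_leI divide_right_mono) linarith+
    finally show ?thesis .
  qed
  define E where "E = (\<integral>\<^sup>+ \<omega>. (\<integral>\<^sup>+ x. ennreal (\<bar>qrnn n V (\<lambda>i. A i \<omega>) (\<lambda>i. B i \<omega>) (W \<omega>) x - f x\<bar>\<^sup>2) \<partial>\<mu>) \<partial>M)"
  have "E = (\<integral>\<^sup>+ \<omega>. (\<integral>\<^sup>+ x. ennreal (((\<Sum>i=1..n. Z x i \<omega>) / n - f x)\<^sup>2) \<partial>\<mu>) \<partial>M)"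
    unfolding E_def F_eq power2_abs ..
  \<comment> \<open>After Tonelli the inner integral is bounded uniformly in \<open>x\<close>, and
    the probability measure \<mu> preserves the bound.\<close>
  also have "\<dots> = (\<integral>\<^sup>+ x. (\<integral>\<^sup>+ \<omega>. ennreal (((\<Sum>i=1..n. Z x i \<omega>) / n - f x)\<^sup>2) \<partial>M) \<partial>\<mu>)"
    unfolding Z_def u_def by (rule Fubini') measurable
  also have "\<dots> \<le> (\<integral>\<^sup>+ x. ennreal (2 * ?E / n) \<partial>\<mu>)"
    by (intro nn_integral_mono pointwise)
  also have "\<dots> = ennreal (2 * ?E / n)"
    by (simp add: \<mu>.emeasure_space_1)
  finally have E: "E \<le> ennreal (2 * ?E / n)" .
  then have fin: "E < \<infinity>" by (rule order.strict_trans1) simp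
  have "enn2real E \<le> 2 * ?E / n"
    using E by (intro enn2real_leI) auto
  then have "sqrt (enn2real E) \<le> L2bar \<pi>\<^sub>a f / sqrt (real n)"
    unfolding L2bar_def real_sqrt_divide[symmetric] by (rule real_sqrt_le_mono)
  with fin W show ?thesis
    unfolding E_def Let_def by (intro bexI[of _ W] conjI)
qed

end
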